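(* Let $k, n, m$ be positive integers with $k < n-2k$. The diagonal action of $\mathbb{P}GL(n)$ on $F(k, n-2k; n)^m$ is dense if and only if $m \leq 3$.
   Context: Work over an algebraically closed field. For integers $0 < k_1 < k_2 < n$ and an $n$-dimensional vector space $V$, $F(k_1, k_2; n)$ denotes the partial flag variety parameterizing flags $W_{k_1} \subset W_{k_2} \subset V$ of linear subspaces with $\dim W_{k_i} = k_i$. The group $\mathbb{P}GL(n) = \mathbb{P}GL(V)$ acts on $F(k_1,k_2;n)$ and hence diagonally on the $m$-fold self-product $F(k_1,k_2;n)^m$. The action is called dense if it has a (Zariski) dense orbit. *)

theory Defs
  imports
    "HOL-Analysis.Analysis"
    "HOL-Algebra.Group_Action"
    "Jordan_Normal_Form.Determinant"
begin

text \<open>Throughout, \<open>V = K\<^sup>n\<close> is rendered as \<open>'a^'n\<close> with \<open>n = CARD('n)\<close>.\<close>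

definition flag_variety :: "nat \<Rightarrow> nat \<Rightarrow> (('a::field^'n) set \<times> ('a^'n) set) set" where
  "flag_variety k1 k2 =
     {(W1, W2). vec.subspace W1 \<and> vec.subspace W2 \<and> W1 \<subseteq> W2 \<and> vec.dim W1 = k1 \<and> vec.dim W2 = k2}"

definition flag_power ::
  "nat \<Rightarrow> nat \<Rightarrow> nat \<Rightarrow> (nat \<Rightarrow> ('a::field^'n) set \<times> ('a^'n) set) set" where
  "flag_power k1 k2 m = (\<Pi>\<^sub>E i\<in>{..<m}. flag_variety k1 k2)"

definition GL :: "('a::field^'n^'n) monoid" where
  "GL = \<lparr>carrier = {A. invertible A}, mult = (**), one = Finite_Cartesian_Product.mat 1\<rparr>"

definition scalar_matrices :: "('a::field^'n^'n) set" where
  "scalar_matrices = {Finite_Cartesian_Product.mat c | c. c \<noteq> 0}"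

definition PGL :: "('a::field^'n^'n) set monoid" where
  "PGL = GL Mod scalar_matrices"

text \<open>An element of \<open>PGL\<close> is a class of matrices that differ by nonzero scalars; all of them have
  the same image on a subspace, so the union below is the image under any representative
  (lemma \<open>subspace_act_eq\<close>).\<close>

definition subspace_act :: "('a::field^'n^'n) set \<Rightarrow> ('a^'n) set \<Rightarrow> ('a^'n) set" where
  "subspace_act g W = (\<Union>A\<in>g. (*v) A ` W)"

definition flag_act ::
  "('a::field^'n^'n) set \<Rightarrow> ('a^'n) set \<times> ('a^'n) set \<Rightarrow> ('a^'n) set \<times> ('a^'n) set" where
  "flag_act g F = (subspace_act g (fst F), subspace_act g (snd F))"

definition diag_act ::
  "nat \<Rightarrow> ('a::field^'n^'n) set \<Rightarrow> (nat \<Rightarrow> ('a^'n) set \<times> ('a^'n) set)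
     \<Rightarrow> (nat \<Rightarrow> ('a^'n) set \<times> ('a^'n) set)" where
  "diag_act m g x = (\<lambda>i\<in>{..<m}. flag_act g (x i))"

text \<open>The Pluecker coordinates of the span of \<open>w 0, \<dots>, w (d-1)\<close> are the \<open>d \<times> d\<close> minors of the
  matrix with these rows. Since \<open>'n\<close> carries no order, they are indexed by all column selections
  \<open>J\<close>, of which only \<open>J 0, \<dots>, J (d-1)\<close> matter; this merely repeats the usual coordinates up to
  sign and adds zeros.\<close>

definition minors :: "nat \<Rightarrow> (nat \<Rightarrow> 'a::field^'n) \<Rightarrow> (nat \<Rightarrow> 'n) \<Rightarrow> 'a" where
  "minors d w J = Determinant.det (Matrix.mat d d (\<lambda>(i, j). vec_nth (w i) (J j)))"

text \<open>A spanning family of \<open>vec.dim W\<close> vectors is an ordered basis, so this is the set of all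
  Pluecker coordinate vectors of \<open>W\<close>; they differ by nonzero scalars (lemma \<open>pluecker_unique\<close>).\<close>

definition pluecker :: "('a::field^'n) set \<Rightarrow> ((nat \<Rightarrow> 'n) \<Rightarrow> 'a) set" where
  "pluecker W = {minors (vec.dim W) w | w. vec.span (w ` {..<vec.dim W}) = W}"

text \<open>\<open>multiform B e f\<close>: the function \<open>f\<close> is given by a polynomial in the coordinates \<open>x b c\<close>
  (\<open>b \<in> B\<close>) that is homogeneous of degree \<open>e b\<close> in the block of variables \<open>x b\<close>, for each \<open>b\<close>.\<close>

inductive multiform ::
  "'b set \<Rightarrow> ('b \<Rightarrow> nat) \<Rightarrow> (('b \<Rightarrow> 'c \<Rightarrow> 'a::field) \<Rightarrow> 'a) \<Rightarrow> bool" for B where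
  const: "multiform B (\<lambda>_. 0) (\<lambda>_. a)"
| coord: "b \<in> B \<Longrightarrow> multiform B (\<lambda>b'. if b' = b then 1 else 0) (\<lambda>x. x b c)"
| add: "multiform B e f \<Longrightarrow> multiform B e g \<Longrightarrow> multiform B e (\<lambda>x. f x + g x)"
| mult: "multiform B e f \<Longrightarrow> multiform B e' g \<Longrightarrow> multiform B (\<lambda>b. e b + e' b) (\<lambda>x. f x * g x)"

text \<open>There are \<open>2 m\<close> blocks: \<open>(i, False)\<close> and \<open>(i, True)\<close> belong to the smaller and the larger
  subspace of the \<open>i\<close>-th flag.\<close>

definition flag_coords ::
  "nat \<Rightarrow> (nat \<Rightarrow> ('a::field^'n) set \<times> ('a^'n) set) \<Rightarrow> (nat \<times> bool \<Rightarrow> (nat \<Rightarrow> 'n) \<Rightarrow> 'a) set" where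
  "flag_coords m x =
     {p. \<forall>i<m. p (i, False) \<in> pluecker (fst (x i)) \<and> p (i, True) \<in> pluecker (snd (x i))}"

text \<open>The nonvanishing loci of multihomogeneous polynomials are a base of the Zariski topology
  of the product of the flag varieties, embedded in a product of \<open>2 m\<close> projective spaces. By
  homogeneity, the choice of \<open>p\<close> is irrelevant (lemma \<open>nonvanishing_iff\<close>).\<close>

definition nonvanishing ::
  "nat \<Rightarrow> nat \<Rightarrow> nat \<Rightarrow> ((nat \<times> bool \<Rightarrow> (nat \<Rightarrow> 'n) \<Rightarrow> 'a) \<Rightarrow> 'a)
     \<Rightarrow> (nat \<Rightarrow> ('a::field^'n) set \<times> ('a^'n) set) set" where
  "nonvanishing k1 k2 m f = {x \<in> flag_power k1 k2 m. \<exists>p\<in>flag_coords m x. f p \<noteq> 0}"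

definition flag_zariski ::
  "nat \<Rightarrow> nat \<Rightarrow> nat \<Rightarrow> (nat \<Rightarrow> ('a::field^'n) set \<times> ('a^'n) set) topology" where
  "flag_zariski k1 k2 m =
     topology_generated_by {nonvanishing k1 k2 m f | f e. multiform ({..<m} \<times> UNIV) e f}"

definition dense_action :: "'g monoid \<Rightarrow> ('g \<Rightarrow> 'x \<Rightarrow> 'x) \<Rightarrow> 'x topology \<Rightarrow> bool" where
  "dense_action G \<phi> T \<longleftrightarrow> (\<exists>x\<in>topspace T. Abstract_Topology.closure_of T (orbit G \<phi> x) = topspace T)"

lemma mat_mult_mat:
  "Finite_Cartesian_Product.mat c ** A = (\<chi> i j. c * vec_nth (vec_nth (A::'a::field^'n^'n) i) j)"
  "A ** Finite_Cartesian_Product.mat c = (\<chi> i j. c * vec_nth (vec_nth (A::'a::field^'n^'n) i) j)"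
  by (simp_all add: matrix_matrix_mult_def Finite_Cartesian_Product.mat_def vec_eq_iff
      if_distrib if_distribR sum.delta' mult.commute cong: if_cong)

lemma invertible_scalar: "c \<noteq> 0 \<Longrightarrow> invertible (Finite_Cartesian_Product.mat c :: 'a::field^'n^'n)"
  unfolding invertible_def
  by (rule exI[of _ "Finite_Cartesian_Product.mat (inverse c)"])
    (simp only: mat_mult_mat, auto simp: Finite_Cartesian_Product.mat_def vec_eq_iff fun_eq_iff)

lemma group_GL: "group (GL :: ('a::field^'n^'n) monoid)"
proof (rule groupI)
  fix A :: "'a^'n^'n" assume "A \<in> carrier GL"
  then show "\<exists>B\<in>carrier GL. B \<otimes>\<^bsub>GL\<^esub> A = \<one>\<^bsub>GL\<^esub>"
    by (auto simp: GL_def invertible_def)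
qed (auto simp: GL_def invertible_mult matrix_mul_assoc invertible_scalar)

lemma mat_scalar_mult: "Finite_Cartesian_Product.mat c ** Finite_Cartesian_Product.mat d
    = (Finite_Cartesian_Product.mat (c * d) :: 'a::field^'n^'n)"
  by (simp only: mat_mult_mat, auto simp: Finite_Cartesian_Product.mat_def vec_eq_iff fun_eq_iff)

lemma normal_scalars: "scalar_matrices \<lhd> (GL :: ('a::field^'n^'n) monoid)"
proof -
  interpret group "GL :: ('a^'n^'n) monoid" by (rule group_GL)
  have "subgroup scalar_matrices (GL :: ('a^'n^'n) monoid)"
  proof (rule subgroupI)
    show "scalar_matrices \<subseteq> carrier (GL :: ('a^'n^'n) monoid)"
      by (auto simp: scalar_matrices_def GL_def invertible_scalar)
    have "Finite_Cartesian_Product.mat 1 \<in> (scalar_matrices :: ('a^'n^'n) set)"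
      unfolding scalar_matrices_def using one_neq_zero by blast
    then show "scalar_matrices \<noteq> ({} :: ('a^'n^'n) set)" by blast
  next
    fix A :: "'a^'n^'n" assume "A \<in> scalar_matrices"
    then obtain c where c: "A = Finite_Cartesian_Product.mat c" "c \<noteq> 0"
      by (auto simp: scalar_matrices_def)
    have "inv\<^bsub>GL\<^esub> A = Finite_Cartesian_Product.mat (inverse c)"
      by (rule inv_equality) (use c in \<open>auto simp: GL_def mat_scalar_mult invertible_scalar\<close>)
    then show "inv\<^bsub>GL\<^esub> A \<in> scalar_matrices" using c by (auto simp: scalar_matrices_def)
  next
    fix A B :: "'a^'n^'n" assume "A \<in> scalar_matrices" "B \<in> scalar_matrices"
    then show "A \<otimes>\<^bsub>GL\<^esub> B \<in> scalar_matrices"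
      by (auto simp: scalar_matrices_def GL_def mat_scalar_mult)
  qed
  moreover have "scalar_matrices #>\<^bsub>GL\<^esub> A = A <#\<^bsub>GL\<^esub> scalar_matrices" for A :: "'a^'n^'n"
    by (auto simp: r_coset_def l_coset_def scalar_matrices_def GL_def mat_mult_mat)
  ultimately show ?thesis by (simp add: normalI)
qed

lemma group_PGL: "group (PGL :: ('a::field^'n^'n) set monoid)"
  unfolding PGL_def using normal_scalars by (rule normal.factorgroup_is_group)

lemma subspace_act_eq:
  fixes g :: "('a::field^'n^'n) set"
  assumes "g \<in> carrier PGL" "A \<in> g" "vec.subspace W"
  shows "subspace_act g W = (*v) A ` W"
proof -
  obtain A0 where g: "g = {Finite_Cartesian_Product.mat c ** A0 | c. c \<noteq> 0}"
    using assms(1) unfolding PGL_def carrier_FactGroup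
    by (auto simp: r_coset_def scalar_matrices_def GL_def)
  have scale: "(Finite_Cartesian_Product.mat c ** B) *v w = B *v (c *s w)" for c w and B :: "'a^'n^'n"
    by (simp add: mat_mult_mat matrix_vector_mult_def vec_eq_iff ac_simps)
  have "(*v) (Finite_Cartesian_Product.mat c ** A0) ` W = (*v) A0 ` W" if "c \<noteq> 0" for c
  proof -
    have "(*s) c ` W = W"
    proof
      show "(*s) c ` W \<subseteq> W" using assms(3) by (auto intro: vec.subspace_scale)
      show "W \<subseteq> (*s) c ` W"
      proof
        fix w assume "w \<in> W"
        then have "inverse c *s w \<in> W" using assms(3) by (auto intro: vec.subspace_scale)
        moreover have "w = c *s (inverse c *s w)" using that by (simp add: vec_eq_iff)
        ultimately show "w \<in> (*s) c ` W" by blast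
      qed
    qed
    then show ?thesis unfolding scale by (metis image_image)
  qed
  then have "(*v) B ` W = (*v) A0 ` W" if "B \<in> g" for B using that g by auto
  then show ?thesis using assms(2) unfolding subspace_act_def by (metis (no_types, lifting) SUP_eq_const empty_iff)
qed

lemma minors_change:
  fixes w w' :: "nat \<Rightarrow> 'a::field^'n"
  assumes "\<And>i. i < d \<Longrightarrow> w' i \<in> vec.span (w ` {..<d})"
  shows "\<exists>c. \<forall>J. minors d w' J = c * minors d w J"
proof -
  have "\<exists>u. v = (\<Sum>j<d. u j *s w j)" if "v \<in> vec.span (w ` {..<d})" for v
    using that
  proof (induction rule: vec.span_induct_alt)
    case base
    show ?case by (rule exI[of _ "\<lambda>_. 0"]) simp
  next
    case (step c x y)
    then obtain u j where u: "y = (\<Sum>j<d. u j *s w j)" "j < d" "x = w j" by auto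
    have "(\<Sum>i<d. (if i = j then c else 0) *s w i) = c *s x"
      using u(2,3) by (subst sum.remove[of _ j]) auto
    then have "c *s x + y = (\<Sum>i<d. ((if i = j then c else 0) + u i) *s w i)"
      using u(1) by (simp only: vec.scale_left_distrib sum.distrib)
    then show ?case by (rule exI[of "\<lambda>u. c *s x + y = (\<Sum>i<d. u i *s w i)"])
  qed
  with assms have "\<forall>i\<in>{..<d}. \<exists>u. w' i = (\<Sum>j<d. u j *s w j)" by blast
  from bchoice[OF this] obtain a where a: "\<And>i. i < d \<Longrightarrow> w' i = (\<Sum>j<d. a i j *s w j)"
    by auto
  let ?A = "Matrix.mat d d (\<lambda>(i, j). a i j)"
  have "Matrix.mat d d (\<lambda>(i, j). vec_nth (w' i) (J j))
      = ?A * Matrix.mat d d (\<lambda>(i, j). vec_nth (w i) (J j))" for J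
    by (rule eq_matI) (auto simp: a scalar_prod_def atLeast0LessThan)
  then have "minors d w' J = Determinant.det ?A * minors d w J" for J
    unfolding minors_def by (simp add: det_mult[of _ d])
  then show ?thesis by blast
qed

lemma pluecker_unique:
  assumes "p \<in> pluecker W" "q \<in> pluecker W"
  shows "\<exists>c. c \<noteq> 0 \<and> q = (\<lambda>J. c * p J)"
proof -
  obtain w w' where w: "p = minors (vec.dim W) w" "vec.span (w ` {..<vec.dim W}) = W"
    and w': "q = minors (vec.dim W) w'" "vec.span (w' ` {..<vec.dim W}) = W"
    using assms by (auto simp: pluecker_def)
  have "w' i \<in> vec.span (w ` {..<vec.dim W})" if "i < vec.dim W" for i
    using vec.span_base[of "w' i" "w' ` {..<vec.dim W}"] that unfolding w(2) w'(2) by simp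
  then have "\<exists>c. \<forall>J. q J = c * p J"
    unfolding w(1) w'(1) by (rule minors_change)
  moreover have "w i \<in> vec.span (w' ` {..<vec.dim W})" if "i < vec.dim W" for i
    using vec.span_base[of "w i" "w ` {..<vec.dim W}"] that unfolding w(2) w'(2) by simp
  then have "\<exists>c. \<forall>J. p J = c * q J"
    unfolding w(1) w'(1) by (rule minors_change)
  ultimately obtain c c' where c: "\<forall>J. q J = c * p J" "\<forall>J. p J = c' * q J" by blast
  show ?thesis
  proof (cases "\<forall>J. p J = 0")
    case True
    then have "q = (\<lambda>J. 1 * p J)" using c(1) by (simp add: fun_eq_iff)
    then show ?thesis using one_neq_zero by blast
  next
    case False
    then obtain J where "p J \<noteq> 0" by blast
    moreover have "p J = c' * (c * p J)" using c by metis
    ultimately have "c \<noteq> 0" by auto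
    moreover have "q = (\<lambda>J. c * p J)" using c(1) by blast
    ultimately show ?thesis by blast
  qed
qed

lemma pluecker_nonempty:
  fixes W :: "('a::field^'n) set"
  assumes W: "vec.subspace W"
  shows "pluecker W \<noteq> {}"
proof -
  obtain B where B: "B \<subseteq> W" "vec.independent B" "W \<subseteq> vec.span B" "card B = vec.dim W"
    using vec.basis_exists by metis
  have "finite B" using B(2) by (rule vec.finiteI_independent)
  then obtain w where "w ` {..<vec.dim W} = B"
    using B(4) by (metis atLeast0LessThan bij_betw_def ex_bij_betw_nat_finite)
  moreover have "vec.span B = W" using B W by (metis subset_antisym vec.span_minimal)
  ultimately show ?thesis by (auto simp: pluecker_def)
qed

lemma multiform_scale:
  assumes "multiform (I \<times> UNIV) e f" "\<And>b. b \<in> I \<times> UNIV \<Longrightarrow> c b \<noteq> 0"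
    and "\<And>b. b \<in> I \<times> UNIV \<Longrightarrow> q b = (\<lambda>J. c b * p b J)"
  shows "\<exists>d. d \<noteq> 0 \<and> f q = d * f p"
proof -
  let ?B = "{b \<in> I \<times> UNIV. e b \<noteq> 0}"
  have "finite {b. e b \<noteq> 0} \<and> {b. e b \<noteq> 0} \<subseteq> I \<times> UNIV \<and> f q = (\<Prod>b | e b \<noteq> 0. c b ^ e b) * f p"
    using assms(1)
  proof (induction rule: multiform.induct)
    case (coord b J)
    have "{b'. (if b' = b then 1 else 0::nat) \<noteq> 0} = {b}" by auto
    then show ?case using coord assms(3)[OF coord] by simp
  next
    case (mult e f e' g)
    let ?S = "{b. e b + e' b \<noteq> 0}"
    have S: "?S = {b. e b \<noteq> 0} \<union> {b. e' b \<noteq> 0}" by auto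
    then have fin: "finite ?S" using mult by simp
    have "(\<Prod>b | e b \<noteq> 0. c b ^ e b) = (\<Prod>b\<in>?S. c b ^ e b)"
      "(\<Prod>b | e' b \<noteq> 0. c b ^ e' b) = (\<Prod>b\<in>?S. c b ^ e' b)"
      by (rule prod.mono_neutral_left; use fin in auto)+
    then show ?case using mult fin S
      by (auto simp: power_add prod.distrib ac_simps)
  qed (auto simp: distrib_left)
  then show ?thesis using assms(2) by (intro exI[of _ "\<Prod>b | e b \<noteq> 0. c b ^ e b"]) auto
qed

lemma flag_coords_nonempty:
  assumes "x \<in> flag_power k1 k2 m"
  shows "flag_coords m x \<noteq> {}"
proof -
  have "pluecker (fst (x i)) \<noteq> {}" "pluecker (snd (x i)) \<noteq> {}" if "i < m" for i
    using assms that by (auto simp: flag_power_def flag_variety_def PiE_iff case_prod_beta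
        intro!: pluecker_nonempty)
  then have "(\<lambda>(i, s). SOME p. p \<in> pluecker (if s then snd (x i) else fst (x i))) \<in> flag_coords m x"
    by (auto simp: flag_coords_def some_in_eq)
  then show ?thesis by blast
qed

lemma nonvanishing_iff:
  assumes f: "multiform ({..<m} \<times> UNIV) e f" and p: "p \<in> flag_coords m x"
  shows "x \<in> nonvanishing k1 k2 m f \<longleftrightarrow> x \<in> flag_power k1 k2 m \<and> f p \<noteq> 0"
proof -
  have "f q \<noteq> 0 \<longleftrightarrow> f p \<noteq> 0" if q: "q \<in> flag_coords m x" for q
  proof -
    have "\<exists>c. c \<noteq> 0 \<and> q b = (\<lambda>J. c * p b J)" if "b \<in> {..<m} \<times> UNIV" for b
      using that p q by (cases b; cases "snd b") (auto simp: flag_coords_def intro!: pluecker_unique)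
    then obtain c where "\<And>b. b \<in> {..<m} \<times> UNIV \<Longrightarrow> c b \<noteq> 0 \<and> q b = (\<lambda>J. c b * p b J)"
      by metis
    then obtain d where "d \<noteq> 0 \<and> f q = d * f p"
      using multiform_scale[OF f, of c q p] by auto
    then show ?thesis by simp
  qed
  then show ?thesis using p unfolding nonvanishing_def by blast
qed

lemma topspace_flag_zariski:
  "topspace (flag_zariski k1 k2 m) =
     (flag_power k1 k2 m :: (nat \<Rightarrow> ('a::field^'n) set \<times> ('a^'n) set) set)"
proof -
  have "nonvanishing k1 k2 m (\<lambda>_. 1) =
      (flag_power k1 k2 m :: (nat \<Rightarrow> ('a^'n) set \<times> ('a^'n) set) set)"
    using flag_coords_nonempty by (fastforce simp: nonvanishing_def)
  moreover have "multiform ({..<m} \<times> UNIV) (\<lambda>_. 0)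
      ((\<lambda>_. 1) :: (nat \<times> bool \<Rightarrow> (nat \<Rightarrow> 'n) \<Rightarrow> 'a) \<Rightarrow> 'a)"
    by (rule multiform.const)
  ultimately have "(flag_power k1 k2 m :: (nat \<Rightarrow> ('a^'n) set \<times> ('a^'n) set) set)
      \<in> {nonvanishing k1 k2 m f | f e. multiform ({..<m} \<times> UNIV) e f}"
    by (metis (mono_tags, lifting) mem_Collect_eq)
  moreover have "nonvanishing k1 k2 m f \<subseteq> flag_power k1 k2 m"
    for f :: "(nat \<times> bool \<Rightarrow> (nat \<Rightarrow> 'n) \<Rightarrow> 'a) \<Rightarrow> 'a"
    unfolding nonvanishing_def by (rule Collect_restrict)
  ultimately show ?thesis
    unfolding flag_zariski_def topology_generated_by_topspace by blast
qed

end

theory Submission imports Defs begin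

text \<open>Write \<open>n = 3 k + r\<close> with \<open>r > 0\<close>, and let \<open>A\<^sub>i \<subseteq> B\<^sub>i\<close> be the flags, of dimensions \<open>k\<close> and \<open>k + r\<close>.
  Since \<open>(k + r) + k + k = n\<close>, the determinants \<open>[B\<^sub>i A\<^sub>j A\<^sub>l]\<close> are defined up to scalars, and for four
  flags \<open>[B\<^sub>0 A\<^sub>2 A\<^sub>3] [B\<^sub>3 A\<^sub>0 A\<^sub>1] / ([B\<^sub>0 A\<^sub>1 A\<^sub>3] [B\<^sub>3 A\<^sub>0 A\<^sub>2])\<close> is an invariant rational function. It is not
  constant, as each of the two products vanishes at some point where the other does not; so there
  is no dense orbit for \<open>m \<ge> 4\<close>.

  For \<open>m \<le> 3\<close> an orbit is dense as soon as the orbit map is surjective on tangent spaces at one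
  point, in any characteristic. Choosing a point where \<open>V = A\<^sub>0 \<oplus> A\<^sub>1 \<oplus> A\<^sub>2 \<oplus> C\<close> and \<open>B\<^sub>i\<close> is \<open>A\<^sub>i\<close>
  plus the graph of a linear map \<open>C \<rightarrow> A\<^sub>i\<^sub>+\<^sub>1\<close>, this becomes the surjectivity of
  \<open>(\<beta>\<^sub>i, \<alpha>) \<mapsto> \<beta>\<^sub>i \<phi>\<^sub>i - \<phi>\<^sub>i \<alpha>\<close> for three suitable maps \<open>\<phi>\<^sub>i\<close> from \<open>C\<close> to spaces of dimension \<open>k\<close>,
  which is solved explicitly. (Three arrows out of one vertex form a Dynkin quiver of type \<open>D\<^sub>4\<close>,
  so such maps exist in all dimensions.)\<close>

section \<open>Alternating functions and Laplace expansion\<close>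

lemma minors_Leibniz:
  "minors d w J = (\<Sum>p | p permutes {0..<d}. of_int (sign p) * (\<Prod>i = 0..<d. vec_nth (w i) (J (p i))))"
proof -
  have "(\<Prod>i = 0..<d. Matrix.mat d d (\<lambda>(i, j). vec_nth (w i) (J j)) $$ (i, p i))
      = (\<Prod>i = 0..<d. vec_nth (w i) (J (p i)))" if "p permutes {0..<d}" for p
    using permutes_in_image[OF that] by (intro prod.cong) auto
  then show ?thesis
    unfolding minors_def by (subst det_def'[of _ d]) auto
qed

lemma minors_cong: "(\<And>i. i < d \<Longrightarrow> w i = w' i) \<Longrightarrow> minors d w J = minors d w' J"
  unfolding minors_def by (rule arg_cong[of _ _ Determinant.det], rule eq_matI) auto

text \<open>Vanishing on equal rows, rather than a change of sign, is the right notion in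
  characteristic 2. Families are indexed by all of \<open>nat\<close>, so the last clause confines
  \<open>g\<close> to the rows below \<open>d\<close>.\<close>

definition alternating :: "nat \<Rightarrow> ((nat \<Rightarrow> 'a::field^'n) \<Rightarrow> 'a) \<Rightarrow> bool" where
  "alternating d g \<longleftrightarrow>
     (\<forall>w i a u v. i < d \<longrightarrow> g (w(i := a *s u + v)) = a * g (w(i := u)) + g (w(i := v))) \<and>
     (\<forall>w i j. i < d \<longrightarrow> j < d \<longrightarrow> i \<noteq> j \<longrightarrow> w i = w j \<longrightarrow> g w = 0) \<and>
     (\<forall>w w'. (\<forall>i<d. w i = w' i) \<longrightarrow> g w = g w')"

lemma alternatingD:
  assumes "alternating d g"
  shows alternating_row: "i < d \<Longrightarrow> g (w(i := a *s u + v)) = a * g (w(i := u)) + g (w(i := v))"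
    and alternating_repeat: "i < d \<Longrightarrow> j < d \<Longrightarrow> i \<noteq> j \<Longrightarrow> w i = w j \<Longrightarrow> g w = 0"
    and alternating_cong: "(\<And>i. i < d \<Longrightarrow> w i = w' i) \<Longrightarrow> g w = g w'"
  using assms unfolding alternating_def by auto

lemma alternating_minors: "alternating d (\<lambda>w :: nat \<Rightarrow> 'a::field^'n. minors d w J)"
  unfolding alternating_def
proof (intro conjI allI impI)
  fix w :: "nat \<Rightarrow> 'a^'n" and i a u v
  assume i: "i < d"
  have prod: "(\<Prod>l = 0..<d. vec_nth ((w(i := x)) l) (J (p l)))
      = vec_nth x (J (p i)) * (\<Prod>l\<in>{0..<d} - {i}. vec_nth (w l) (J (p l)))" for x p
    using i by (subst prod.remove[of _ i]) auto
  then show "minors d (w(i := a *s u + v)) J = a * minors d (w(i := u)) J + minors d (w(i := v)) J"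
    unfolding minors_Leibniz sum_distrib_left sum.distrib[symmetric]
    by (intro sum.cong) (auto simp: prod algebra_simps simp del: fun_upd_apply)
next
  fix w :: "nat \<Rightarrow> 'a^'n" and i j
  assume "i < d" "j < d" "i \<noteq> j" "w i = w j"
  then show "minors d w J = 0"
    unfolding minors_def by (intro det_identical_rows[of _ d i j]) auto
qed (simp cong: minors_cong)

lemma alternating_lincomb:
  assumes "alternating d g" "alternating d h"
  shows "alternating d (\<lambda>w. g w + c * h w)"
  unfolding alternating_def
proof (intro conjI allI impI)
  show "g w + c * h w = 0" if "i < d" "j < d" "i \<noteq> j" "w i = w j" for w i j
    using alternating_repeat[OF assms(1) that] alternating_repeat[OF assms(2) that] by simp
  show "g w + c * h w = g w' + c * h w'" if "\<forall>i<d. w i = w' i" for w w'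
    using alternating_cong[OF assms(1), of w w'] alternating_cong[OF assms(2), of w w'] that by simp
  show "g (w(i := a *s u + v)) + c * h (w(i := a *s u + v))
      = a * (g (w(i := u)) + c * h (w(i := u))) + (g (w(i := v)) + c * h (w(i := v)))"
    if "i < d" for w i a u v
    unfolding alternating_row[OF assms(1) that] alternating_row[OF assms(2) that]
    by (simp add: algebra_simps)
qed

lemma alternating_sum:
  assumes "alternating d g" "finite S" "\<And>s. s \<in> S \<Longrightarrow> alternating d (h s)"
  shows "alternating d (\<lambda>w. g w - (\<Sum>s\<in>S. c s * h s w))"
  using assms(2,3)
proof (induction S rule: finite_induct)
  case empty
  then show ?case using assms(1) by simp
next
  case (insert s S)
  then have "alternating d (\<lambda>w. (g w - (\<Sum>s\<in>S. c s * h s w)) + (- c s) * h s w)"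
    by (intro alternating_lincomb) auto
  then show ?case using insert by (simp add: algebra_simps)
qed

lemma alternating_sum_row:
  assumes "alternating d g" "i < d" "finite S"
  shows "g (w(i := (\<Sum>s\<in>S. c s *s u s))) = (\<Sum>s\<in>S. c s * g (w(i := u s)))"
  using assms(3)
proof (induction S rule: finite_induct)
  case empty
  have "g (w(i := 1 *s 0 + 0)) = 1 * g (w(i := 0)) + g (w(i := 0))"
    by (rule alternating_row[OF assms(1,2)])
  then have "g (w(i := 0)) = 0" by (metis add_cancel_right_right mult_1 vec.scale_zero_right add_0)
  then show ?case by (simp del: fun_upd_apply)
next
  case (insert s S)
  then show ?case by (simp add: alternating_row[OF assms(1,2)] del: fun_upd_apply)
qed

text \<open>Polarization: expanding the value 0 at two equal rows \<open>w i + w j\<close> leaves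
  two mixed terms whose sum is 0. Only vanishing is carried along, so no signs have to be
  tracked.\<close>

lemma alternating_transpose:
  assumes g: "alternating d g" and i: "i < d" "j < d"
    and w: "g w = 0"
  shows "g (w \<circ> Transposition.transpose i j) = 0"
proof (cases "i = j")
  case False
  let ?h = "\<lambda>u v. g (w(i := u, j := v))"
  have lin: "?h (u + u') v = ?h u v + ?h u' v" "?h v (u + u') = ?h v u + ?h v u'" for u u' v
  proof -
    have "g ((w(j := v))(i := 1 *s u + u')) = 1 * g ((w(j := v))(i := u)) + g ((w(j := v))(i := u'))"
      by (rule alternating_row[OF g]) (rule i)
    then show "?h (u + u') v = ?h u v + ?h u' v" using False by (simp add: fun_upd_twist)
    have "g ((w(i := v))(j := 1 *s u + u')) = 1 * g ((w(i := v))(j := u)) + g ((w(i := v))(j := u'))"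
      by (rule alternating_row[OF g]) (rule i)
    then show "?h v (u + u') = ?h v u + ?h v u'" by simp
  qed
  have alt: "?h u u = 0" for u
    by (rule alternating_repeat[OF g i False]) simp
  have "?h (w i) (w i) + ?h (w j) (w i) + (?h (w i) (w j) + ?h (w j) (w j)) = 0"
    using alt[of "w i + w j"] by (simp only: lin)
  then have "?h (w i) (w j) + ?h (w j) (w i) = 0"
    unfolding alt by (simp only: add_0 add_0_right add.commute)
  moreover have "w(i := w i, j := w j) = w" "w(i := w j, j := w i) = w \<circ> Transposition.transpose i j"
    by (auto simp: fun_eq_iff transpose_def)
  ultimately show ?thesis using w by simp
qed (use w in simp)

lemma alternating_permutes:
  assumes g: "alternating d g" and p: "p permutes {..<d}" and w: "g w = 0"
  shows "g (w \<circ> p) = 0"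
proof -
  have "finite {..<d}" by simp
  from this p have "\<forall>w. g w = 0 \<longrightarrow> g (w \<circ> p) = 0"
  proof (induction rule: permutes_rev_induct)
    case (swap a b p)
    show ?case
    proof (intro allI impI)
      fix w assume "g w = 0"
      then have "g (w \<circ> p) = 0" using swap by blast
      then show "g (w \<circ> (p \<circ> Transposition.transpose a b)) = 0"
        unfolding comp_assoc[symmetric] using swap by (intro alternating_transpose[OF g]) auto
    qed
  qed simp
  then show ?thesis using w by blast
qed

text \<open>Multilinearity expands the rows in unit vectors one after the other; selections that
  repeat a column contribute 0.\<close>

lemma alternating_eq_0:
  assumes g: "alternating d g" and J: "\<And>J. inj_on J {..<d} \<Longrightarrow> g (\<lambda>i. axis (J i) 1) = 0"
  shows "g w = 0"
proof -
  \<comment> \<open>Induction on the number \<open>m\<close> of leading rows that may still be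
    arbitrary.\<close>
  have "g w = 0" if "m \<le> d" "\<forall>i. m \<le> i \<longrightarrow> i < d \<longrightarrow> (\<exists>x. w i = axis x 1)" for m w
    using that
  proof (induction m arbitrary: w)
    case 0
    then obtain J where Jw: "\<And>i. i < d \<Longrightarrow> w i = axis (J i) 1" by (metis le0)
    show ?case
    proof (cases "inj_on J {..<d}")
      case True
      have "g w = g (\<lambda>i. axis (J i) 1)" by (rule alternating_cong[OF g]) (rule Jw)
      then show ?thesis using J[OF True] by simp
    next
      case False
      then obtain i j where "i < d" "j < d" "i \<noteq> j" "J i = J j" by (auto simp: inj_on_def)
      then show ?thesis by (intro alternating_repeat[OF g, of i j]) (simp_all add: Jw)
    qed
  next
    case (Suc m)
    have "g (w(m := (\<Sum>x\<in>UNIV. vec_nth (w m) x *s axis x 1)))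
        = (\<Sum>x\<in>UNIV. vec_nth (w m) x * g (w(m := axis x 1)))"
      using Suc.prems by (intro alternating_sum_row[OF g]) auto
    also have "\<dots> = 0"
    proof (intro sum.neutral ballI)
      fix x
      have "g (w(m := axis x 1)) = 0"
        using Suc.prems by (intro Suc.IH) (auto simp: Suc_le_eq)
      then show "vec_nth (w m) x * g (w(m := axis x 1)) = 0" by simp
    qed
    finally show ?case by (simp add: basis_expansion)
  qed
  from this[of d] show ?thesis by simp
qed

text \<open>One enumeration is chosen for each set of \<open>d\<close> columns, since
  \<open>'n\<close> has no order that would single out increasing selections. The unit rows and the
  minors so indexed are dual to each other (\<open>minors_axis\<close>).\<close>

definition column_sets :: "nat \<Rightarrow> (nat \<Rightarrow> 'n::finite) set" where
  "column_sets d = (\<lambda>S. SOME J. bij_betw J {..<d} S) ` {S. card S = d}"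

lemma column_sets:
  shows "finite (column_sets d :: (nat \<Rightarrow> 'n::finite) set)"
    and "\<And>J :: nat \<Rightarrow> 'n. J \<in> column_sets d \<Longrightarrow> inj_on J {..<d}"
    and "\<And>J J' :: nat \<Rightarrow> 'n. J \<in> column_sets d \<Longrightarrow> J' \<in> column_sets d \<Longrightarrow> J \<noteq> J' \<Longrightarrow>
      J ` {..<d} \<noteq> J' ` {..<d}"
    and "\<And>J :: nat \<Rightarrow> 'n. inj_on J {..<d} \<Longrightarrow> \<exists>J'\<in>column_sets d. J' ` {..<d} = J ` {..<d}"
proof -
  define E :: "'n set \<Rightarrow> nat \<Rightarrow> 'n" where "E S = (SOME J. bij_betw J {..<d} S)" for S
  have C: "column_sets d = E ` {S. card S = d}" unfolding column_sets_def E_def ..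
  have bij: "bij_betw (E S) {..<d} S" if "card S = d" for S
  proof -
    have "\<exists>J. bij_betw J {..<d} S"
      using ex_bij_betw_nat_finite[of S] that by (simp add: atLeast0LessThan)
    then show ?thesis unfolding E_def by (rule someI_ex)
  qed
  then have im: "E S ` {..<d} = S" if "card S = d" for S
    using that by (simp add: bij_betw_def)
  show "finite (column_sets d :: (nat \<Rightarrow> 'n) set)" unfolding C by (rule finite_imageI) (rule finite)
  show "inj_on J {..<d}" if J: "J \<in> column_sets d" for J :: "nat \<Rightarrow> 'n"
  proof -
    obtain S where "J = E S" "card S = d" using J unfolding C by blast
    then show ?thesis using bij by (simp add: bij_betw_def)
  qed
  show "J ` {..<d} \<noteq> J' ` {..<d}"
    if J: "J \<in> column_sets d" "J' \<in> column_sets d" "J \<noteq> J'" for J J' :: "nat \<Rightarrow> 'n"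
  proof -
    obtain S S' where "J = E S" "card S = d" "J' = E S'" "card S' = d" using J unfolding C by blast
    then show ?thesis using J(3) im by metis
  qed
  show "\<exists>J'\<in>column_sets d. J' ` {..<d} = J ` {..<d}" if J: "inj_on J {..<d}" for J :: "nat \<Rightarrow> 'n"
  proof
    show "E (J ` {..<d}) ` {..<d} = J ` {..<d}" using J by (intro im) (simp add: card_image)
    show "E (J ` {..<d}) \<in> column_sets d" unfolding C using J by (simp add: card_image)
  qed
qed

lemma minors_axis_self:
  assumes "inj_on J {..<d}"
  shows "minors d (\<lambda>i. axis (J i) 1) J = 1"
proof -
  have "Matrix.mat d d (\<lambda>(i, j). vec_nth (axis (J i) 1) (J j)) = (1\<^sub>m d :: 'b mat)"
    using assms by (intro eq_matI) (auto simp: axis_def inj_on_def)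
  then show ?thesis unfolding minors_def by simp
qed

text \<open>If the selections differ, so do their images, which have equal size. Hence some row has
  its only nonzero entry outside the columns of \<open>J'\<close>, and every Leibniz product
  contains 0.\<close>

lemma minors_axis:
  assumes "J \<in> column_sets d" "J' \<in> column_sets d"
  shows "minors d (\<lambda>i. axis (J i) 1) J' = (if J = J' then 1 else 0)"
proof (cases "J = J'")
  case True
  then show ?thesis using minors_axis_self[OF column_sets(2)[OF assms(1)]] by simp
next
  case False
  have "card (J ` {..<d}) = card (J' ` {..<d})"
    using column_sets(2)[OF assms(1)] column_sets(2)[OF assms(2)] by (simp add: card_image)
  then have "\<not> J ` {..<d} \<subseteq> J' ` {..<d}"
    using column_sets(3)[OF assms False] by (metis card_subset_eq finite)
  then obtain i where i: "i < d" "J i \<notin> J' ` {..<d}" by blast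
  have "(\<Prod>l = 0..<d. vec_nth (axis (J l) 1) (J' (p l))) = (0 :: 'b)" if "p permutes {0..<d}" for p
  proof (rule prod_zero)
    have "p i \<in> {..<d}" using permutes_in_image[OF that, of i] i by simp
    then have "J i \<noteq> J' (p i)" using i by blast
    then show "\<exists>l\<in>{0..<d}. vec_nth (axis (J l) 1) (J' (p l)) = (0 :: 'b)"
      using i by (auto simp: axis_def)
  qed simp
  then have "minors d (\<lambda>i. axis (J i) 1) J' = (0 :: 'b)"
    unfolding minors_Leibniz by (intro sum.neutral ballI) (simp only: mem_Collect_eq mult_zero_right)
  then show ?thesis using False by simp
qed

lemma same_image_permutes:
  assumes J: "inj_on J {..<d}" and J': "inj_on J' {..<d}" and im: "J ` {..<d} = J' ` {..<d}"
  shows "\<exists>p. p permutes {..<d} \<and> (\<forall>i<d. J i = J' (p i))"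
proof (intro exI conjI allI impI)
  let ?p = "\<lambda>i. if i < d then the_inv_into {..<d} J' (J i) else i"
  have "bij_betw (the_inv_into {..<d} J' \<circ> J) {..<d} {..<d}"
    using bij_betw_trans[OF inj_on_imp_bij_betw[OF J], unfolded im,
        OF bij_betw_the_inv_into[OF inj_on_imp_bij_betw[OF J']]] .
  then have "bij_betw ?p {..<d} {..<d}"
    by (rule bij_betw_cong[THEN iffD1, rotated]) auto
  then show "?p permutes {..<d}" by (intro bij_imp_permutes) auto
  show "J i = J' (?p i)" if "i < d" for i
  proof -
    have "J i \<in> J' ` {..<d}" using that im by blast
    then show ?thesis using f_the_inv_into_f[OF J'] that by simp
  qed
qed

text \<open>The difference of the two sides is alternating. It vanishes on the unit rows of the
  chosen selections by duality, and on those of any other injective selection because the rows are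
  merely permuted.\<close>

lemma alternating_expansion:
  fixes g :: "(nat \<Rightarrow> 'a::field^'n::finite) \<Rightarrow> 'a"
  assumes g: "alternating d g"
  shows "g w = (\<Sum>J\<in>column_sets d. g (\<lambda>i. axis (J i) 1) * minors d w J)"
proof -
  let ?h = "\<lambda>w. g w - (\<Sum>J\<in>column_sets d. g (\<lambda>i. axis (J i) 1) * minors d w J)"
  have h: "alternating d ?h"
    by (intro alternating_sum g column_sets alternating_minors)
  have "?h w = 0"
  proof (rule alternating_eq_0[OF h])
    fix J :: "nat \<Rightarrow> 'n" assume J: "inj_on J {..<d}"
    then obtain J' where J': "J' \<in> column_sets d" "J' ` {..<d} = J ` {..<d}"
      using column_sets(4) by blast
    have inj: "inj_on J' {..<d}" using column_sets(2) J' by blast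
    then obtain p where p: "p permutes {..<d}" and Jp: "\<And>i. i < d \<Longrightarrow> J i = J' (p i)"
      using same_image_permutes[OF J inj J'(2)[symmetric]] by blast
    have "(\<Sum>J\<in>column_sets d. g (\<lambda>i. axis (J i) 1) * minors d (\<lambda>i. axis (J' i) 1) J)
        = (\<Sum>J\<in>column_sets d. if J = J' then g (\<lambda>i. axis (J i) 1) else 0)"
      using J' by (intro sum.cong) (auto simp: minors_axis)
    then have "?h (\<lambda>i. axis (J' i) 1) = 0" using J' by (simp add: column_sets(1))
    then have "?h ((\<lambda>i. axis (J' i) 1) \<circ> p) = 0"
      by (rule alternating_permutes[OF h p])
    moreover have "?h ((\<lambda>i. axis (J' i) 1) \<circ> p) = ?h (\<lambda>i. axis (J i) 1)"
      by (rule alternating_cong[OF h]) (simp add: Jp)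
    ultimately show "?h (\<lambda>i. axis (J i) 1) = 0" by simp
  qed
  then show ?thesis by simp
qed

section \<open>Laplace expansion along three blocks of rows\<close>

definition append_rows :: "nat \<Rightarrow> (nat \<Rightarrow> 'b) \<Rightarrow> (nat \<Rightarrow> 'b) \<Rightarrow> nat \<Rightarrow> 'b" where
  "append_rows d w w' = (\<lambda>i. if i < d then w i else w' (i - d))"

lemma append_rows_upd:
  "i < d \<Longrightarrow> append_rows d (w(i := u)) w' = (append_rows d w w')(i := u)"
  "append_rows d w (w'(i := u)) = (append_rows d w w')(d + i := u)"
  by (auto simp: append_rows_def fun_eq_iff)

lemma alternating_append_rows:
  assumes g: "alternating n g" and "d + d' = n"
  shows "alternating d (\<lambda>w. g (append_rows d w w'))"
    and "alternating d' (\<lambda>w'. g (append_rows d w w'))"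
proof -
  note D = alternating_row[OF g] alternating_repeat[OF g] alternating_cong[OF g]
  show "alternating d (\<lambda>w. g (append_rows d w w'))"
    unfolding alternating_def
  proof (intro conjI allI impI)
    show "g (append_rows d w w') = 0" if "i < d" "j < d" "i \<noteq> j" "w i = w j" for w i j
      using that assms(2) by (intro D(2)[of i j]) (auto simp: append_rows_def)
    show "g (append_rows d w w') = g (append_rows d v w')" if "\<forall>i<d. w i = v i" for w v
      using that by (intro D(3)) (auto simp: append_rows_def)
    show "g (append_rows d (w(i := a *s u + v)) w')
        = a * g (append_rows d (w(i := u)) w') + g (append_rows d (w(i := v)) w')"
      if "i < d" for w i a u v
      unfolding append_rows_upd(1)[OF that] using that assms(2) by (intro D(1)) simp
  qed
  show "alternating d' (\<lambda>w'. g (append_rows d w w'))"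
    unfolding alternating_def
  proof (intro conjI allI impI)
    show "g (append_rows d w w') = 0" if "i < d'" "j < d'" "i \<noteq> j" "w' i = w' j" for w' i j
      using that assms(2) by (intro D(2)[of "d + i" "d + j"]) (auto simp: append_rows_def)
    show "g (append_rows d w v) = g (append_rows d w w')" if "\<forall>i<d'. v i = w' i" for w' v
      using that assms(2) by (intro D(3)) (auto simp: append_rows_def)
    show "g (append_rows d w (w'(i := a *s u + v)))
        = a * g (append_rows d w (w'(i := u))) + g (append_rows d w (w'(i := v)))"
      if "i < d'" for w' i a u v
      unfolding append_rows_upd(2) using that assms(2) by (intro D(1)) simp
  qed
qed

definition unit_rows :: "(nat \<Rightarrow> 'n) \<Rightarrow> nat \<Rightarrow> 'a::field^'n" where
  "unit_rows J = (\<lambda>i. axis (J i) 1)"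

text \<open>The value is alternating in each block while the other two are held fixed, so the
  expansion in minors applies to each block in turn. A determinant thus becomes a trilinear form in
  the Pluecker coordinates of the three row spans.\<close>

lemma alternating_Laplace3:
  fixes g :: "(nat \<Rightarrow> 'a::field^'n::finite) \<Rightarrow> 'a"
  assumes g: "alternating n g" and d: "d1 + (d2 + d3) = n"
  shows "g (append_rows d1 w1 (append_rows d2 w2 w3)) =
    (\<Sum>J1\<in>column_sets d1. \<Sum>J2\<in>column_sets d2. \<Sum>J3\<in>column_sets d3.
      g (append_rows d1 (unit_rows J1) (append_rows d2 (unit_rows J2) (unit_rows J3)))
        * minors d1 w1 J1 * minors d2 w2 J2 * minors d3 w3 J3)"
proof -
  have 1: "alternating d1 (\<lambda>w. g (append_rows d1 w w'))"
    and 2: "alternating (d2 + d3) (\<lambda>w. g (append_rows d1 w' w))" for w'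
    using alternating_append_rows[OF g d] by blast+
  have 3: "alternating d2 (\<lambda>w. g (append_rows d1 w' (append_rows d2 w w'')))"
    and 4: "alternating d3 (\<lambda>w. g (append_rows d1 w' (append_rows d2 w'' w)))" for w' w''
    using alternating_append_rows[OF 2 refl] by blast+
  have "g (append_rows d1 w1 (append_rows d2 w2 w3)) =
      (\<Sum>J1\<in>column_sets d1. g (append_rows d1 (unit_rows J1) (append_rows d2 w2 w3)) * minors d1 w1 J1)"
    unfolding unit_rows_def by (rule alternating_expansion[OF 1])
  moreover have "g (append_rows d1 u (append_rows d2 w2 w3)) =
      (\<Sum>J2\<in>column_sets d2. g (append_rows d1 u (append_rows d2 (unit_rows J2) w3)) * minors d2 w2 J2)" for u
    unfolding unit_rows_def by (rule alternating_expansion[OF 3])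
  moreover have "g (append_rows d1 u (append_rows d2 v w3)) =
      (\<Sum>J3\<in>column_sets d3. g (append_rows d1 u (append_rows d2 v (unit_rows J3))) * minors d3 w3 J3)" for u v
    unfolding unit_rows_def by (rule alternating_expansion[OF 4])
  ultimately have "g (append_rows d1 w1 (append_rows d2 w2 w3)) =
    (\<Sum>J1\<in>column_sets d1. (\<Sum>J2\<in>column_sets d2. (\<Sum>J3\<in>column_sets d3.
      g (append_rows d1 (unit_rows J1) (append_rows d2 (unit_rows J2) (unit_rows J3)))
        * minors d3 w3 J3) * minors d2 w2 J2) * minors d1 w1 J1)"
    by (simp only:)
  then show ?thesis unfolding sum_distrib_right by (simp only: ac_simps)
qed

section \<open>Determinants as multihomogeneous polynomials\<close>

lemma multiform_zero:
  fixes f :: "('b \<Rightarrow> 'c \<Rightarrow> 'a::field) \<Rightarrow> 'a"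
  assumes "multiform B e f"
  shows "multiform B e (\<lambda>_ :: 'b \<Rightarrow> 'c \<Rightarrow> 'a. 0)"
  using multiform.mult[OF multiform.const[of B 0] assms] by simp

lemma multiform_cmult:
  assumes "multiform B e f"
  shows "multiform B e (\<lambda>x. a * f x)"
  using multiform.mult[OF multiform.const[of B a] assms] by simp

text \<open>The form \<open>h\<close> serves the empty sum: 0 is obtained in degree \<open>e\<close>
  as 0 times a form of that degree.\<close>

lemma multiform_sum:
  fixes f :: "'s \<Rightarrow> ('b \<Rightarrow> 'c \<Rightarrow> 'a::field) \<Rightarrow> 'a" and h :: "('b \<Rightarrow> 'c \<Rightarrow> 'a::field) \<Rightarrow> 'a"
  assumes "finite S" "\<And>s. s \<in> S \<Longrightarrow> multiform B e (f s)" "multiform B e h"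
  shows "multiform B e (\<lambda>x. \<Sum>s\<in>S. f s x)"
  using assms
proof (induction S rule: finite_induct)
  case empty
  then show ?case using multiform_zero[OF assms(3)] by simp
next
  case (insert s S)
  then show ?case by (simp add: multiform.add)
qed

abbreviation block_deg :: "'b \<Rightarrow> 'b \<Rightarrow> nat" where
  "block_deg b \<equiv> (\<lambda>b'. if b' = b then 1 else 0)"

text \<open>The polynomial is the Laplace expansion with the block minors replaced by variables; its
  coefficients are determinants of unit rows.\<close>

lemma multiform_det:
  fixes \<iota> :: "nat \<Rightarrow> 'n::finite"
  assumes "b1 \<in> B" "b2 \<in> B" "b3 \<in> B" "d1 + (d2 + d3) = n"
  obtains f :: "('b \<Rightarrow> (nat \<Rightarrow> 'n) \<Rightarrow> 'a::field) \<Rightarrow> 'a"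
  where "multiform B (\<lambda>b. block_deg b1 b + (block_deg b2 b + block_deg b3 b)) f"
    and "\<And>x w1 w2 w3. x b1 = minors d1 w1 \<Longrightarrow> x b2 = minors d2 w2 \<Longrightarrow> x b3 = minors d3 w3 \<Longrightarrow>
      f x = minors n (append_rows d1 w1 (append_rows d2 w2 w3)) \<iota>"
proof
  let ?c = "\<lambda>J1 J2 J3. minors n (append_rows d1 (unit_rows J1)
      (append_rows d2 (unit_rows J2) (unit_rows J3) :: nat \<Rightarrow> 'a^'n)) \<iota>"
  let ?f = "\<lambda>x :: 'b \<Rightarrow> (nat \<Rightarrow> 'n) \<Rightarrow> 'a. (\<Sum>J1\<in>column_sets d1. \<Sum>J2\<in>column_sets d2. \<Sum>J3\<in>column_sets d3.
      ?c J1 J2 J3 * (x b1 J1 * (x b2 J2 * x b3 J3)))"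
  have m: "multiform B (\<lambda>b. block_deg b1 b + (block_deg b2 b + block_deg b3 b))
      (\<lambda>x. x b1 J1 * (x b2 J2 * x b3 J3))" for J1 J2 J3
    using assms by (intro multiform.mult multiform.coord)
  show "multiform B (\<lambda>b. block_deg b1 b + (block_deg b2 b + block_deg b3 b)) ?f"
    by (intro multiform_sum column_sets(1) multiform_cmult) (rule m)+
  show "?f x = minors n (append_rows d1 w1 (append_rows d2 w2 w3)) \<iota>"
    if "x b1 = minors d1 w1" "x b2 = minors d2 w2" "x b3 = minors d3 w3" for x w1 w2 w3
    using alternating_Laplace3[OF alternating_minors assms(4), of w1 w2 w3 \<iota>]
    unfolding that by (simp only: mult.assoc)
qed

section \<open>Flags spanned by rows\<close>

definition flag_of :: "nat \<Rightarrow> nat \<Rightarrow> (nat \<Rightarrow> 'a::field^'n) \<Rightarrow> ('a^'n) set \<times> ('a^'n) set" where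
  "flag_of k1 k2 w = (vec.span (w ` {..<k1}), vec.span (w ` {..<k2}))"

lemma flag_of_in_variety:
  assumes "k1 \<le> k2" "inj_on w {..<k2}" "vec.independent (w ` {..<k2})"
  shows "flag_of k1 k2 w \<in> flag_variety k1 k2"
proof -
  have sub: "w ` {..<k1} \<subseteq> w ` {..<k2}" using assms(1) by auto
  have ind: "vec.independent (w ` {..<k1})" using vec.independent_mono[OF assms(3) sub] .
  have inj: "inj_on w {..<k1}" using assms(1,2) by (auto simp: inj_on_def)
  show ?thesis
    using vec.span_mono[OF sub] vec.dim_span_eq_card_independent[OF ind]
      vec.dim_span_eq_card_independent[OF assms(3)] inj assms(2)
    by (simp add: flag_variety_def flag_of_def card_image)
qed

text \<open>A basis of the smaller space is extended to one of the larger space and listed first, so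
  that initial segments of a single family span both.\<close>

lemma flag_basis:
  assumes F: "F \<in> flag_variety k1 k2"
  obtains w where "F = flag_of k1 k2 w"
proof -
  obtain W1 W2 where W: "F = (W1, W2)" "vec.subspace W1" "vec.subspace W2" "W1 \<subseteq> W2"
    "vec.dim W1 = k1" "vec.dim W2 = k2"
    using F by (auto simp: flag_variety_def)
  obtain B1 where B1: "B1 \<subseteq> W1" "vec.independent B1" "W1 \<subseteq> vec.span B1" "card B1 = k1"
    using vec.basis_exists W(5) by metis
  obtain B2 where B2: "B1 \<subseteq> B2" "B2 \<subseteq> W2" "vec.independent B2" "W2 \<subseteq> vec.span B2"
    using vec.maximal_independent_subset_extend[OF _ B1(2), of W2] B1(1) W(4) by blast
  have fin: "finite B2" using B2(3) by (rule vec.finiteI_independent)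
  have card: "card B2 = k2"
    using vec.dim_unique[OF B2(2) B2(4) B2(3) refl] W(6) by simp
  have card': "card (B2 - B1) = k2 - k1"
    using card_Diff_subset[of B1 B2] B1(4) B2(1) fin card finite_subset by auto
  have "k1 \<le> k2" using card_mono[OF fin B2(1)] B1(4) card by simp
  obtain u where u: "bij_betw u {0..<k1} B1"
    using ex_bij_betw_nat_finite[of B1] B1(4) B2(1) fin finite_subset by blast
  obtain v where v: "bij_betw v {0..<k2 - k1} (B2 - B1)"
    using ex_bij_betw_nat_finite[of "B2 - B1"] card' fin by auto
  define w where "w i = (if i < k1 then u i else v (i - k1))" for i
  have w1: "w ` {..<k1} = B1"
    using u by (auto simp: w_def bij_betw_def atLeast0LessThan)
  have "{..<k2} = {..<k1} \<union> (\<lambda>i. i + k1) ` {0..<k2 - k1}"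
    using \<open>k1 \<le> k2\<close> by (auto simp: image_iff intro!: bexI[of _ "_ - k1"])
  moreover have "w ` (\<lambda>i. i + k1) ` {0..<k2 - k1} = B2 - B1"
  proof -
    have "w (i + k1) = v i" for i by (simp add: w_def)
    then show ?thesis using v by (simp only: image_image bij_betw_def)
  qed
  ultimately have w2: "w ` {..<k2} = B2"
    using w1 B2(1) by (auto simp: image_Un)
  have "vec.span B1 = W1" "vec.span B2 = W2"
    using B1 B2 W by (metis subset_antisym vec.span_minimal)+
  then have "F = flag_of k1 k2 w" by (simp add: flag_of_def w1 w2 W(1))
  then show ?thesis by (rule that)
qed

definition flag_minors ::
  "nat \<Rightarrow> nat \<Rightarrow> (nat \<Rightarrow> nat \<Rightarrow> 'a::field^'n) \<Rightarrow> nat \<times> bool \<Rightarrow> (nat \<Rightarrow> 'n) \<Rightarrow> 'a" where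
  "flag_minors k1 k2 w = (\<lambda>(i, s). minors (if s then k2 else k1) (w i))"

definition flags_of ::
  "nat \<Rightarrow> nat \<Rightarrow> nat \<Rightarrow> (nat \<Rightarrow> nat \<Rightarrow> 'a::field^'n) \<Rightarrow> nat \<Rightarrow> ('a^'n) set \<times> ('a^'n) set" where
  "flags_of k1 k2 m w = (\<lambda>i\<in>{..<m}. flag_of k1 k2 (w i))"

lemma flags_of_in_power:
  "flags_of k1 k2 m w \<in> flag_power k1 k2 m \<longleftrightarrow> (\<forall>i<m. flag_of k1 k2 (w i) \<in> flag_variety k1 k2)"
  by (auto simp: flags_of_def flag_power_def PiE_iff)

lemma flags_basis:
  assumes "x \<in> flag_power k1 k2 m"
  obtains w where "x = flags_of k1 k2 m w"
proof -
  have "\<forall>i\<in>{..<m}. \<exists>w. x i = flag_of k1 k2 w"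
    using assms flag_basis by (metis PiE_mem flag_power_def)
  then obtain w where "\<forall>i\<in>{..<m}. x i = flag_of k1 k2 (w i)" by (rule bchoice[THEN exE])
  moreover have "x \<in> extensional {..<m}"
    using assms by (simp add: flag_power_def PiE_def)
  ultimately have "x = flags_of k1 k2 m w"
    by (auto simp: flags_of_def extensional_def fun_eq_iff)
  then show ?thesis by (rule that)
qed

lemma flag_minors_in_coords:
  assumes "flags_of k1 k2 m w \<in> flag_power k1 k2 m"
  shows "flag_minors k1 k2 w \<in> flag_coords m (flags_of k1 k2 m w)"
proof -
  have pl: "minors d v \<in> pluecker (vec.span (v ` {..<d}))"
    if "vec.dim (vec.span (v ` {..<d})) = d" for d and v :: "nat \<Rightarrow> 'a^'n"
    unfolding pluecker_def that by blast
  have "minors k1 (w i) \<in> pluecker (vec.span (w i ` {..<k1}))"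
    "minors k2 (w i) \<in> pluecker (vec.span (w i ` {..<k2}))" if "i < m" for i
    using assms that unfolding flags_of_in_power flag_variety_def flag_of_def
    by (auto intro!: pl simp del: vec.dim_span)
  then show ?thesis by (simp add: flag_coords_def flag_minors_def flags_of_def flag_of_def)
qed

section \<open>Orbits in terms of matrices, and a criterion for density\<close>

lemma orbit_flags_of:
  fixes w :: "nat \<Rightarrow> nat \<Rightarrow> 'a::field^'n"
  shows "orbit PGL (diag_act m) (flags_of k1 k2 m w) =
    {flags_of k1 k2 m (\<lambda>i j. A *v w i j) | A :: 'a^'n^'n. invertible A}"
proof -
  \<comment> \<open>Three facts link classes to matrices: any representative describes the action on
    spanning rows (\<open>act\<close>), every class contains an invertible matrix
    (\<open>rep\<close>), and every invertible matrix lies in a class (\<open>cls\<close>).\<close>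
  have act: "diag_act m g (flags_of k1 k2 m w) = flags_of k1 k2 m (\<lambda>i j. A *v w i j)"
    if "g \<in> carrier PGL" "A \<in> g" for g A
  proof -
    have "subspace_act g (vec.span (w i ` S)) = vec.span ((\<lambda>j. A *v w i j) ` S)" for i S
      using subspace_act_eq[OF that vec.subspace_span, of "w i ` S"]
        vec.linear_span_image[OF matrix_vector_mul_linear_gen, of A "w i ` S"]
      by (simp add: image_image)
    then have "flag_act g (flag_of k1 k2 (w i)) = flag_of k1 k2 (\<lambda>j. A *v w i j)" for i
      by (simp add: flag_act_def flag_of_def)
    then show ?thesis
      unfolding diag_act_def flags_of_def by (intro restrict_ext) simp
  qed
  have rep: "\<exists>A\<in>g. invertible A" if "g \<in> carrier PGL" for g :: "('a^'n^'n) set"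
  proof -
    obtain A where A: "invertible A" "g = scalar_matrices #>\<^bsub>GL\<^esub> A"
      using \<open>g \<in> carrier PGL\<close> unfolding PGL_def carrier_FactGroup by (auto simp: GL_def)
    have "A \<in> carrier GL" using A(1) by (simp add: GL_def)
    then have "A \<in> g"
      unfolding A(2) by (rule group.rcos_self[OF group_GL _ normal_imp_subgroup[OF normal_scalars]])
    then show ?thesis using A by blast
  qed
  have cls: "\<exists>g\<in>carrier PGL. A \<in> g" if "invertible A" for A :: "'a^'n^'n"
  proof (rule bexI)
    have "A \<in> carrier GL" using that by (simp add: GL_def)
    then show "A \<in> scalar_matrices #>\<^bsub>GL\<^esub> A"
      by (rule group.rcos_self[OF group_GL _ normal_imp_subgroup[OF normal_scalars]])
    show "scalar_matrices #>\<^bsub>GL\<^esub> A \<in> carrier PGL"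
      unfolding PGL_def carrier_FactGroup using that by (auto simp: GL_def)
  qed
  show ?thesis
  proof (rule Set.set_eqI)
    fix y
    have "y \<in> orbit PGL (diag_act m) (flags_of k1 k2 m w) \<longleftrightarrow>
        (\<exists>g\<in>carrier PGL. y = diag_act m g (flags_of k1 k2 m w))"
      unfolding orbit_def by blast
    also have "\<dots> \<longleftrightarrow> (\<exists>A. invertible A \<and> y = flags_of k1 k2 m (\<lambda>i j. A *v w i j))"
      using act rep cls by metis
    finally show "y \<in> orbit PGL (diag_act m) (flags_of k1 k2 m w) \<longleftrightarrow>
        y \<in> {flags_of k1 k2 m (\<lambda>i j. A *v w i j) | A :: 'a^'n^'n. invertible A}"
      by blast
  qed
qed

lemma invertible_flag_of:
  assumes A: "invertible (A :: 'a::field^'n^'n)" and w: "flag_of k1 k2 w \<in> flag_variety k1 k2"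
  shows "flag_of k1 k2 (\<lambda>j. A *v w j) \<in> flag_variety k1 k2"
proof -
  have lin: "Vector_Spaces.linear (*s) (*s) ((*v) A)" by (rule matrix_vector_mul_linear_gen)
  have inj: "inj ((*v) A)" using A by (simp add: invertible_left_inverse matrix_left_invertible_injective)
  have span: "vec.span ((\<lambda>j. A *v w j) ` S) = (*v) A ` vec.span (w ` S)" for S
    using vec.linear_span_image[OF lin, of "w ` S"] by (simp add: image_image)
  have "vec.dim ((*v) A ` W) = vec.dim W" for W
    using vec.dim_image_eq[OF lin] inj by (meson inj_on_subset subset_UNIV)
  then show ?thesis
    using w vec.linear_subspace_image[OF lin] by (auto simp: flag_of_def flag_variety_def span)
qed

text \<open>The nonvanishing loci are only given as generators of the topology. They form a base
  because the locus of a product is the intersection of the two loci.\<close>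

lemma nonvanishing_nhds_base:
  assumes "openin (flag_zariski k1 k2 m) U" "x \<in> U"
  shows "\<exists>f e. multiform ({..<m} \<times> UNIV) e f \<and> x \<in> nonvanishing k1 k2 m f \<and>
    nonvanishing k1 k2 m f \<subseteq> (U :: (nat \<Rightarrow> ('a::field^'n) set \<times> ('a^'n) set) set)"
  using assms unfolding flag_zariski_def openin_topology_generated_by_iff
proof (induction rule: generate_topology_on.induct)
  case (Int a b)
  have "x \<in> a" "x \<in> b" using Int.prems by auto
  from Int.IH(1)[OF this(1)] Int.IH(2)[OF this(2)]
  obtain f e g e' where f: "multiform ({..<m} \<times> UNIV) e f" "x \<in> nonvanishing k1 k2 m f"
      "nonvanishing k1 k2 m f \<subseteq> a"
    and g: "multiform ({..<m} \<times> UNIV) e' g" "x \<in> nonvanishing k1 k2 m g"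
      "nonvanishing k1 k2 m g \<subseteq> b"
    by blast
  have fg: "multiform ({..<m} \<times> UNIV) (\<lambda>b. e b + e' b) (\<lambda>x. f x * g x)"
    using f(1) g(1) by (rule multiform.mult)
  have eq: "nonvanishing k1 k2 m (\<lambda>x. f x * g x) = nonvanishing k1 k2 m f \<inter> nonvanishing k1 k2 m g"
  proof (rule Set.set_eqI)
    fix y :: "nat \<Rightarrow> ('a^'n) set \<times> ('a^'n) set"
    show "y \<in> nonvanishing k1 k2 m (\<lambda>x. f x * g x) \<longleftrightarrow>
        y \<in> nonvanishing k1 k2 m f \<inter> nonvanishing k1 k2 m g"
    proof (cases "y \<in> flag_power k1 k2 m")
      case True
      then obtain p where "p \<in> flag_coords m y" using flag_coords_nonempty by blast
      then show ?thesis
        using nonvanishing_iff[OF f(1)] nonvanishing_iff[OF g(1)] nonvanishing_iff[OF fg] by auto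
    qed (simp add: nonvanishing_def)
  qed
  show ?case
  proof (intro exI conjI)
    show "x \<in> nonvanishing k1 k2 m (\<lambda>x. f x * g x)" unfolding eq using f(2) g(2) by simp
    show "nonvanishing k1 k2 m (\<lambda>x. f x * g x) \<subseteq> a \<inter> b" unfolding eq using f(3) g(3) by auto
  qed (rule fg)
next
  case (UN K)
  then obtain k where k: "k \<in> K" "x \<in> k" by blast
  from UN.IH[OF this] show ?case using k(1) by (meson Union_upper order_trans)
next
  case (Basis s)
  then show ?case by blast
qed simp

text \<open>As the nonvanishing loci form a base, density only requires the orbit to meet every
  nonempty one. Expressed through spanning rows, this removes the topology and the quotient group
  from the rest of the proof.\<close>

lemma dense_action_iff:
  "dense_action (PGL :: ('a::field^'n^'n) set monoid) (diag_act m) (flag_zariski k1 k2 m) \<longleftrightarrow>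
    (\<exists>w :: nat \<Rightarrow> nat \<Rightarrow> 'a^'n. (\<forall>i<m. flag_of k1 k2 (w i) \<in> flag_variety k1 k2) \<and>
      (\<forall>e f. multiform ({..<m} \<times> UNIV) e f \<longrightarrow>
        (\<exists>v. (\<forall>i<m. flag_of k1 k2 (v i) \<in> flag_variety k1 k2) \<and> f (flag_minors k1 k2 v) \<noteq> 0) \<longrightarrow>
        (\<exists>A :: 'a^'n^'n. invertible A \<and> f (flag_minors k1 k2 (\<lambda>i j. A *v w i j)) \<noteq> 0)))"
    (is "_ \<longleftrightarrow> (\<exists>w. ?fl w \<and> ?meets w)")
proof -
  let ?T = "flag_zariski k1 k2 m :: (nat \<Rightarrow> ('a^'n) set \<times> ('a^'n) set) topology"
  have nv: "flags_of k1 k2 m v \<in> nonvanishing k1 k2 m f \<longleftrightarrow> f (flag_minors k1 k2 v) \<noteq> 0"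
    if "multiform ({..<m} \<times> UNIV) e f" "?fl v" for e f v
    using nonvanishing_iff[OF that(1) flag_minors_in_coords, of k1 k2 v] that(2)
    by (simp add: flags_of_in_power)
  have orb: "Abstract_Topology.closure_of ?T (orbit PGL (diag_act m) (flags_of k1 k2 m w)) = topspace ?T
      \<longleftrightarrow> ?meets w" if w: "?fl w" for w
  proof -
    have flA: "?fl (\<lambda>i j. A *v w i j)" if "invertible A" for A
      using w invertible_flag_of[OF that] by simp
    show ?thesis
    proof
    assume cl: "Abstract_Topology.closure_of ?T (orbit PGL (diag_act m) (flags_of k1 k2 m w)) = topspace ?T"
    show "?meets w"
    proof (intro allI impI)
      fix e f
      assume f: "multiform ({..<m} \<times> UNIV) e f"
        and "\<exists>v. ?fl v \<and> f (flag_minors k1 k2 v) \<noteq> 0"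
      then obtain v where v: "?fl v" "f (flag_minors k1 k2 v) \<noteq> 0" by blast
      have "flags_of k1 k2 m v \<in> topspace ?T"
        using v(1) unfolding topspace_flag_zariski flags_of_in_power .
      then have "flags_of k1 k2 m v \<in> Abstract_Topology.closure_of ?T
          (orbit PGL (diag_act m) (flags_of k1 k2 m w))"
        unfolding cl .
      moreover have "flags_of k1 k2 m v \<in> nonvanishing k1 k2 m f" using nv[OF f v(1)] v(2) by simp
      moreover have "openin ?T (nonvanishing k1 k2 m f)"
        unfolding flag_zariski_def using f by (intro topology_generated_by_Basis) blast
      ultimately obtain y where "y \<in> orbit PGL (diag_act m) (flags_of k1 k2 m w)"
          "y \<in> nonvanishing k1 k2 m f"
        unfolding in_closure_of by blast
      then obtain A where A: "invertible A"
          "flags_of k1 k2 m (\<lambda>i j. A *v w i j) \<in> nonvanishing k1 k2 m f"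
        unfolding orbit_flags_of by blast
      then have "f (flag_minors k1 k2 (\<lambda>i j. A *v w i j)) \<noteq> 0"
        using nv[OF f flA[OF A(1)]] by simp
      with A(1) show "\<exists>A. invertible A \<and> f (flag_minors k1 k2 (\<lambda>i j. A *v w i j)) \<noteq> 0"
        by blast
    qed
  next
    assume meets: "?meets w"
    show "Abstract_Topology.closure_of ?T (orbit PGL (diag_act m) (flags_of k1 k2 m w)) = topspace ?T"
    proof (rule subset_antisym[OF closure_of_subset_topspace subsetI])
      fix x assume x: "x \<in> topspace ?T"
      show "x \<in> Abstract_Topology.closure_of ?T (orbit PGL (diag_act m) (flags_of k1 k2 m w))"
        unfolding in_closure_of
      proof (intro conjI allI impI x)
        fix U assume "x \<in> U \<and> openin ?T U"
        then obtain f e where f: "multiform ({..<m} \<times> UNIV) e f" "x \<in> nonvanishing k1 k2 m f"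
            "nonvanishing k1 k2 m f \<subseteq> U"
          using nonvanishing_nhds_base[of k1 k2 m U x] by blast
        obtain v where v: "x = flags_of k1 k2 m v"
          using x flags_basis unfolding topspace_flag_zariski by blast
        have flv: "?fl v" using x unfolding topspace_flag_zariski v flags_of_in_power .
        then have "f (flag_minors k1 k2 v) \<noteq> 0" using nv[OF f(1) flv] f(2) v by simp
        then obtain A where A: "invertible A" "f (flag_minors k1 k2 (\<lambda>i j. A *v w i j)) \<noteq> 0"
          using meets f(1) flv by blast
        then have "flags_of k1 k2 m (\<lambda>i j. A *v w i j) \<in> U"
          using nv[OF f(1) flA[OF A(1)]] f(3) by blast
        moreover have "flags_of k1 k2 m (\<lambda>i j. A *v w i j) \<in> orbit PGL (diag_act m) (flags_of k1 k2 m w)"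
          unfolding orbit_flags_of using A(1) by blast
        ultimately show "\<exists>y. y \<in> orbit PGL (diag_act m) (flags_of k1 k2 m w) \<and> y \<in> U"
          by blast
      qed
    qed
  qed
  qed
  show ?thesis
  proof
    assume "dense_action (PGL :: ('a^'n^'n) set monoid) (diag_act m) ?T"
    then obtain x :: "nat \<Rightarrow> ('a^'n) set \<times> ('a^'n) set" where x: "x \<in> flag_power k1 k2 m"
      "Abstract_Topology.closure_of ?T (orbit PGL (diag_act m) x) = topspace ?T"
      unfolding dense_action_def topspace_flag_zariski by blast
    then obtain w where w: "x = flags_of k1 k2 m w" using flags_basis by blast
    then have "?fl w" using x(1) by (simp add: flags_of_in_power)
    moreover have "?meets w" using orb[OF \<open>?fl w\<close>] x(2) unfolding w by (rule iffD1)
    ultimately show "\<exists>w. ?fl w \<and> ?meets w" by blast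
  next
    assume "\<exists>w. ?fl w \<and> ?meets w"
    then obtain w where w: "?fl w" "?meets w" by blast
    have "flags_of k1 k2 m w \<in> topspace ?T"
      using w(1) unfolding topspace_flag_zariski flags_of_in_power .
    moreover have "Abstract_Topology.closure_of ?T (orbit PGL (diag_act m) (flags_of k1 k2 m w)) = topspace ?T"
      using orb[OF w(1)] w(2) by (rule iffD2)
    ultimately show "dense_action (PGL :: ('a^'n^'n) set monoid) (diag_act m) ?T"
      unfolding dense_action_def by blast
  qed
qed

section \<open>An invariant of four flags\<close>

lemma flag_of_axis:
  assumes "k1 \<le> k2" "inj_on J {..<k2}"
  shows "flag_of k1 k2 (\<lambda>j. axis (J j) 1 :: 'a::field^'n) \<in> flag_variety k1 k2"
proof (rule flag_of_in_variety[OF assms(1)])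
  show "inj_on (\<lambda>j. axis (J j) 1 :: 'a^'n) {..<k2}"
    using assms(2) by (auto simp: inj_on_def axis_eq_axis)
  show "vec.independent ((\<lambda>j. axis (J j) 1 :: 'a^'n) ` {..<k2})"
    by (rule vec.independent_mono[OF independent_cart_basis]) (auto simp: cart_basis_def)
qed

context
  fixes k r n :: nat and \<iota> :: "nat \<Rightarrow> 'n::finite"
  assumes k: "0 < k" and r: "0 < r" and n: "n = 3 * k + r" and \<iota>: "bij_betw \<iota> {..<n} UNIV"
begin

text \<open>The factor is the determinant of \<open>A\<close>, transposed because the vectors are
  the rows. It does not depend on \<open>w\<close>, so all brackets scale alike.\<close>

lemma minors_matrix_mult:
  fixes A :: "'a::field^'n^'n"
  shows "\<exists>c. \<forall>w. minors n (\<lambda>i. A *v w i) \<iota> = c * minors n w \<iota>"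
proof -
  let ?A = "Matrix.mat n n (\<lambda>(i, j). vec_nth (vec_nth A (\<iota> j)) (\<iota> i))"
  have "vec_nth (A *v v) (\<iota> j) = (\<Sum>l<n. vec_nth v (\<iota> l) * vec_nth (vec_nth A (\<iota> j)) (\<iota> l))" for v j
    unfolding matrix_vector_mult_def using sum.reindex_bij_betw[OF \<iota>, symmetric]
    by (simp add: mult.commute)
  then have "Matrix.mat n n (\<lambda>(i, j). vec_nth (A *v w i) (\<iota> j))
      = Matrix.mat n n (\<lambda>(i, j). vec_nth (w i) (\<iota> j)) * ?A" for w
    by (intro eq_matI) (auto simp: scalar_prod_def atLeast0LessThan)
  then have "minors n (\<lambda>i. A *v w i) \<iota> = Determinant.det ?A * minors n w \<iota>" for w
    unfolding minors_def by (simp add: det_mult[of _ n])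
  then show ?thesis by blast
qed

text \<open>A surjection of a finite set onto itself is a permutation, so these are the rows of the
  identity matrix rearranged. Surjectivity will be checked by naming a preimage of each
  coordinate.\<close>

lemma minors_axis_nonzero:
  assumes "{..<n} \<subseteq> \<tau> ` {..<n}"
  shows "minors n (\<lambda>i. axis (\<iota> (\<tau> i)) 1 :: 'a::field^'n) \<iota> \<noteq> 0"
proof
  assume 0: "minors n (\<lambda>i. axis (\<iota> (\<tau> i)) 1 :: 'a^'n) \<iota> = 0"
  have inj: "inj_on \<iota> {..<n}" using \<iota> by (simp add: bij_betw_def)
  have \<tau>: "\<tau> ` {..<n} = {..<n}"
    using assms card_image_le[of "{..<n}" \<tau>] by (intro card_seteq[symmetric]) auto
  then have inj\<tau>: "inj_on \<tau> {..<n}" by (simp add: eq_card_imp_inj_on)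
  then have "inj_on (\<iota> \<circ> \<tau>) {..<n}" "\<iota> ` {..<n} = (\<iota> \<circ> \<tau>) ` {..<n}"
    using comp_inj_on[OF inj\<tau>, of \<iota>] inj by (simp_all only: image_comp[symmetric] \<tau>)
  then obtain p where p: "p permutes {..<n}" "\<And>i. i < n \<Longrightarrow> \<iota> i = (\<iota> \<circ> \<tau>) (p i)"
    using same_image_permutes[OF inj] by blast
  have "minors n ((\<lambda>i. axis (\<iota> (\<tau> i)) 1 :: 'a^'n) \<circ> p) \<iota> = 0"
    by (rule alternating_permutes[OF alternating_minors p(1) 0])
  moreover have "minors n ((\<lambda>i. axis (\<iota> (\<tau> i)) 1 :: 'a^'n) \<circ> p) \<iota> = minors n (\<lambda>i. axis (\<iota> i) 1) \<iota>"
    by (rule minors_cong) (simp add: p(2))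
  moreover have "minors n (\<lambda>i. axis (\<iota> i) 1 :: 'a^'n) \<iota> = 1" by (rule minors_axis_self[OF inj])
  ultimately show False by simp
qed

text \<open>The determinant \<open>[B_i A_j A_l]\<close> of the overview: \<open>w i\<close>
  contributes the \<open>k + r\<close> rows of the larger subspace, \<open>w j\<close> and
  \<open>w l\<close> only the \<open>k\<close> rows of the smaller ones.\<close>

definition bracket :: "nat \<Rightarrow> nat \<Rightarrow> nat \<Rightarrow> (nat \<Rightarrow> nat \<Rightarrow> 'a::field^'n) \<Rightarrow> 'a" where
  "bracket i j l w = minors n (append_rows (k + r) (w i) (append_rows k (w j) (w l))) \<iota>"

lemma multiform_bracket:
  assumes "i < m" "j < m" "l < m"
  obtains f :: "(nat \<times> bool \<Rightarrow> (nat \<Rightarrow> 'n) \<Rightarrow> 'a::field) \<Rightarrow> 'a"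
  where "multiform ({..<m} \<times> UNIV)
      (\<lambda>b. block_deg (i, True) b + (block_deg (j, False) b + block_deg (l, False) b)) f"
    and "\<And>w. f (flag_minors k (k + r) w) = bracket i j l w"
proof -
  obtain f :: "(nat \<times> bool \<Rightarrow> (nat \<Rightarrow> 'n) \<Rightarrow> 'a) \<Rightarrow> 'a"
  where f: "multiform ({..<m} \<times> UNIV)
      (\<lambda>b. block_deg (i, True) b + (block_deg (j, False) b + block_deg (l, False) b)) f"
    and f': "\<And>x w1 w2 w3. x (i, True) = minors (k + r) w1 \<Longrightarrow> x (j, False) = minors k w2 \<Longrightarrow>
      x (l, False) = minors k w3 \<Longrightarrow>
      f x = minors n (append_rows (k + r) w1 (append_rows k w2 w3)) \<iota>"
    by (rule multiform_det[of "(i, True)" "{..<m} \<times> UNIV" "(j, False)" "(l, False)" "k + r" k k n \<iota>])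
      (use assms n in auto)
  show ?thesis
    by (rule that[OF f]) (unfold bracket_def, rule f', simp_all add: flag_minors_def)
qed

lemma bracket_matrix_mult:
  fixes A :: "'a::field^'n^'n"
  shows "\<exists>c. \<forall>i j l w. bracket i j l (\<lambda>i j. A *v w i j) = c * bracket i j l w"
proof -
  obtain c where c: "\<And>w. minors n (\<lambda>i. A *v w i) \<iota> = c * minors n w \<iota>"
    using minors_matrix_mult by blast
  have "append_rows d (\<lambda>j. A *v u j) (\<lambda>j. A *v v j) = (\<lambda>j. A *v append_rows d u v j)" for d u v
    by (auto simp: append_rows_def)
  then show ?thesis by (simp add: bracket_def c)
qed

definition unit_flags :: "(nat \<Rightarrow> nat \<Rightarrow> nat) \<Rightarrow> nat \<Rightarrow> nat \<Rightarrow> 'a::field^'n" where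
  "unit_flags \<sigma> = (\<lambda>i j. axis (\<iota> (\<sigma> i j)) 1)"

lemma bracket_unit_flags:
  "bracket i j l (unit_flags \<sigma>) =
    minors n (\<lambda>x. axis (\<iota> (append_rows (k + r) (\<sigma> i) (append_rows k (\<sigma> j) (\<sigma> l)) x)) 1) \<iota>"
  unfolding bracket_def unit_flags_def by (rule minors_cong) (simp add: append_rows_def)

text \<open>Coordinate flags: \<open>A\<^sub>0, A\<^sub>3\<close> and the common part of \<open>A\<^sub>1, A\<^sub>2\<close> lie in the first \<open>3 k\<close> coordinates,
  but \<open>A\<^sub>1\<close> has the coordinate \<open>3 k\<close> of \<open>B\<^sub>0\<close> in place of \<open>3 k - 1\<close>.\<close>

definition special_index :: "nat \<Rightarrow> nat \<Rightarrow> nat" where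
  "special_index i j =
    (if i = 0 \<and> j < k then j
     else if i = 1 \<and> j = k - 1 then 3 * k
     else if i = 1 \<and> j = k then 3 * k - 1
     else if i = 3 \<and> j < k then j + k
     else if i = 3 \<and> j = k then 3 * k - 1
     else j + 2 * k)"

lemma special_index_inj: "inj_on (special_index i) {..<k + r}"
  "special_index i ` {..<k + r} \<subseteq> {..<n}"
proof -
  show "inj_on (special_index i) {..<k + r}"
  proof (rule inj_onI)
    fix x y assume "x \<in> {..<k + r}" "y \<in> {..<k + r}" "special_index i x = special_index i y"
    then show "x = y" using k r n unfolding special_index_def by (simp split: if_splits)
  qed
  show "special_index i ` {..<k + r} \<subseteq> {..<n}"
  proof (rule image_subsetI)
    fix x assume "x \<in> {..<k + r}"
    then show "special_index i x \<in> {..<n}" using k r n unfolding special_index_def by auto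
  qed
qed

lemma flag_of_unit_flags:
  "flag_of k (k + r) (unit_flags special_index i :: nat \<Rightarrow> 'a::field^'n) \<in> flag_variety k (k + r)"
proof -
  have "inj_on (\<iota> \<circ> special_index i) {..<k + r}"
    using special_index_inj \<iota> by (intro comp_inj_on) (auto simp: bij_betw_def inj_on_subset)
  then show ?thesis
    using flag_of_axis[of k "k + r" "\<iota> \<circ> special_index i"] by (simp add: unit_flags_def)
qed

lemma bracket_special:
  shows "bracket 0 2 3 (unit_flags special_index) \<noteq> (0 :: 'a::field)"
    and "bracket 3 0 1 (unit_flags special_index) \<noteq> (0 :: 'a)"
    and "bracket 0 1 3 (unit_flags special_index) = (0 :: 'a)"
proof -
  show "bracket 0 2 3 (unit_flags special_index) \<noteq> (0 :: 'a)"
    unfolding bracket_unit_flags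
  proof (intro minors_axis_nonzero subsetI)
    fix y assume "y \<in> {..<n}"
    \<comment> \<open>Each coordinate is traced to the flag that contains it. The witnesses are its
      positions in the concatenated list, whose blocks start at \<open>0\<close>,
      \<open>k + r\<close> and \<open>2 * k + r\<close>.\<close>
    then consider "y < k" | "k \<le> y \<and> y < 2 * k" | "2 * k \<le> y \<and> y < 3 * k" | "3 * k \<le> y \<and> y < 3 * k + r"
      using n by fastforce
    then show "y \<in> append_rows (k + r) (special_index 0) (append_rows k (special_index 2) (special_index 3)) ` {..<n}"
    proof cases
      case 1
      then show ?thesis
        using k r n by (intro image_eqI[of _ _ "y"]) (auto simp: append_rows_def special_index_def)
    next
      case 2
      then show ?thesis
        using k r n by (intro image_eqI[of _ _ "y + k + r"]) (auto simp: append_rows_def special_index_def)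
    next
      case 3
      then show ?thesis
        using k r n by (intro image_eqI[of _ _ "y + r - k"]) (auto simp: append_rows_def special_index_def)
    next
      case 4
      then show ?thesis
        using k r n by (intro image_eqI[of _ _ "y - 2 * k"]) (auto simp: append_rows_def special_index_def)
    qed
  qed
  show "bracket 3 0 1 (unit_flags special_index) \<noteq> (0 :: 'a)"
    unfolding bracket_unit_flags
  proof (intro minors_axis_nonzero subsetI)
    fix y assume "y \<in> {..<n}"
    then consider "y < k" | "k \<le> y \<and> y < 2 * k" | "2 * k \<le> y \<and> y < 3 * k - 1" | "y = 3 * k - 1" | "y = 3 * k" | "3 * k < y \<and> y < 3 * k + r"
      using n by fastforce
    then show "y \<in> append_rows (k + r) (special_index 3) (append_rows k (special_index 0) (special_index 1)) ` {..<n}"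
    proof cases
      case 1
      then show ?thesis
        using k r n by (intro image_eqI[of _ _ "y + k + r"]) (auto simp: append_rows_def special_index_def)
    next
      case 2
      then show ?thesis
        using k r n by (intro image_eqI[of _ _ "y - k"]) (auto simp: append_rows_def special_index_def)
    next
      case 3
      then show ?thesis
        using k r n by (intro image_eqI[of _ _ "y + r"]) (auto simp: append_rows_def special_index_def)
    next
      case 4
      then show ?thesis
        using k r n by (intro image_eqI[of _ _ "k"]) (auto simp: append_rows_def special_index_def)
    next
      case 5
      then show ?thesis
        using k r n by (intro image_eqI[of _ _ "3 * k + r - 1"]) (auto simp: append_rows_def special_index_def)
    next
      case 6
      then show ?thesis
        using k r n by (intro image_eqI[of _ _ "y - 2 * k"]) (auto simp: append_rows_def special_index_def)
    qed
  qed
  \<comment> \<open>Row \<open>k\<close> comes from \<open>B_0\<close> and row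
    \<open>2 * k + r - 1\<close> is the last one of \<open>A_1\<close>; both are the unit vector of
    the coordinate \<open>3 * k\<close>.\<close>
  have "2 * k + r - 1 - (k + r) = k - 1" "\<not> 2 * k + r - 1 < k + r" "k - 1 < k" using k by auto
  then show "bracket 0 1 3 (unit_flags special_index) = (0 :: 'a)"
    unfolding bracket_unit_flags using k r n
    by (intro alternating_repeat[OF alternating_minors, of k n "2 * k + r - 1"])
      (simp_all add: append_rows_def special_index_def)
qed

end

lemma diag_act_not_dense:
  assumes k: "0 < k" and r: "0 < r" and card: "CARD('n::finite) = 3 * k + r" and m: "4 \<le> m"
  shows "\<not> dense_action (PGL :: ('a::field^'n^'n) set monoid) (diag_act m) (flag_zariski k (k + r) m)"
proof
  assume "dense_action (PGL :: ('a::field^'n^'n) set monoid) (diag_act m) (flag_zariski k (k + r) m)"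
  then obtain w :: "nat \<Rightarrow> nat \<Rightarrow> 'a^'n" where
    meets: "\<forall>e f. multiform ({..<m} \<times> UNIV) e f \<longrightarrow>
        (\<exists>v. (\<forall>i<m. flag_of k (k + r) (v i) \<in> flag_variety k (k + r)) \<and>
          f (flag_minors k (k + r) v) \<noteq> 0) \<longrightarrow>
        (\<exists>A :: 'a^'n^'n. invertible A \<and> f (flag_minors k (k + r) (\<lambda>i j. A *v w i j)) \<noteq> 0)"
    unfolding dense_action_iff by (elim exE conjE) (rule that)
  define n where "n = 3 * k + r"
  obtain \<iota> :: "nat \<Rightarrow> 'n" where \<iota>: "bij_betw \<iota> {..<n} UNIV"
    using ex_bij_betw_nat_finite[of "UNIV :: 'n set"] card by (auto simp: n_def atLeast0LessThan)
  let ?br = "bracket k r n \<iota>"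
  have m': "0 < m" "1 < m" "2 < m" "3 < m" using m by auto
  note mb = multiform_bracket[OF k r n_def \<iota>]
  obtain f1 :: "(nat \<times> bool \<Rightarrow> (nat \<Rightarrow> 'n) \<Rightarrow> 'a) \<Rightarrow> 'a"
    where f1: "multiform ({..<m} \<times> UNIV) (\<lambda>b. block_deg (0, True) b + (block_deg (2, False) b + block_deg (3, False) b)) f1"
      "\<And>w. f1 (flag_minors k (k + r) w) = ?br 0 2 3 w"
    by (rule mb[OF m'(1) m'(3) m'(4)]) (rule that)
  obtain f2 :: "(nat \<times> bool \<Rightarrow> (nat \<Rightarrow> 'n) \<Rightarrow> 'a) \<Rightarrow> 'a"
    where f2: "multiform ({..<m} \<times> UNIV) (\<lambda>b. block_deg (3, True) b + (block_deg (0, False) b + block_deg (1, False) b)) f2"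
      "\<And>w. f2 (flag_minors k (k + r) w) = ?br 3 0 1 w"
    by (rule mb[OF m'(4) m'(1) m'(2)]) (rule that)
  obtain f3 :: "(nat \<times> bool \<Rightarrow> (nat \<Rightarrow> 'n) \<Rightarrow> 'a) \<Rightarrow> 'a"
    where f3: "multiform ({..<m} \<times> UNIV) (\<lambda>b. block_deg (0, True) b + (block_deg (1, False) b + block_deg (3, False) b)) f3"
      "\<And>w. f3 (flag_minors k (k + r) w) = ?br 0 1 3 w"
    by (rule mb[OF m'(1) m'(2) m'(4)]) (rule that)
  obtain f4 :: "(nat \<times> bool \<Rightarrow> (nat \<Rightarrow> 'n) \<Rightarrow> 'a) \<Rightarrow> 'a"
    where f4: "multiform ({..<m} \<times> UNIV) (\<lambda>b. block_deg (3, True) b + (block_deg (0, False) b + block_deg (2, False) b)) f4"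
      "\<And>w. f4 (flag_minors k (k + r) w) = ?br 3 0 2 w"
    by (rule mb[OF m'(4) m'(1) m'(3)]) (rule that)
  define I where "I w = ?br 0 2 3 w * ?br 3 0 1 w" for w :: "nat \<Rightarrow> nat \<Rightarrow> 'a^'n"
  define I' where "I' w = ?br 0 1 3 w * ?br 3 0 2 w" for w :: "nat \<Rightarrow> nat \<Rightarrow> 'a^'n"
  \<comment> \<open>A linear relation at \<open>w\<close> replaces the value of the quotient, which
    need not be defined there; if both products vanish, any coefficients satisfy it.\<close>
  obtain a b where ab: "a * I w + b * I' w = 0" "a \<noteq> 0 \<or> b \<noteq> 0"
  proof (cases "I w = 0 \<and> I' w = 0")
    case True
    then show ?thesis using that[of 1 0] by simp
  next
    case False
    then show ?thesis using that[of "I' w" "- I w"] by (auto simp: algebra_simps)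
  qed
  define f where "f x = a * (f1 x * f2 x) + b * (f3 x * f4 x)" for x
  \<comment> \<open>Both products contain \<open>B_0\<close>, \<open>B_3\<close> and each of
    \<open>A_0\<close>, \<open>A_1\<close>, \<open>A_2\<close>, \<open>A_3\<close> exactly once, so
    they have the same multidegree.\<close>
  let ?e = "\<lambda>b. (block_deg (0, True) b + (block_deg (2, False) b + block_deg (3, False) b))
      + (block_deg (3, True) b + (block_deg (0, False) b + block_deg (1, False) b)) :: nat"
  have e: "?e = (\<lambda>b. (block_deg (0, True) b + (block_deg (1, False) b + block_deg (3, False) b))
      + (block_deg (3, True) b + (block_deg (0, False) b + block_deg (2, False) b)))"
    by (rule ext) (simp only: ac_simps)
  have "multiform ({..<m} \<times> UNIV) ?e (\<lambda>x. b * (f3 x * f4 x))"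
    unfolding e using f3(1) f4(1) by (intro multiform_cmult multiform.mult)
  then have f: "multiform ({..<m} \<times> UNIV) ?e f"
    unfolding f_def by (rule multiform.add[OF multiform_cmult[OF multiform.mult[OF f1(1) f2(1)]]])
  have fv: "f (flag_minors k (k + r) v) = a * I v + b * I' v" for v
    by (simp add: f_def f1 f2 f3 f4 I_def I'_def)
  have "f (flag_minors k (k + r) (\<lambda>i j. A *v w i j)) = 0" for A :: "'a^'n^'n"
  proof -
    obtain c where c: "\<And>i j l. ?br i j l (\<lambda>i j. A *v w i j) = c * ?br i j l w"
      using bracket_matrix_mult[OF k r n_def \<iota>] by blast
    have "f (flag_minors k (k + r) (\<lambda>i j. A *v w i j)) = c * c * (a * I w + b * I' w)"
      unfolding fv I_def I'_def c by (simp add: algebra_simps)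
    then show ?thesis using ab(1) by simp
  qed
  note 0 = this
  \<comment> \<open>\<open>f\<close> is 0 on the whole orbit of \<open>w\<close>; if it were nonzero
    at some flags, the dense orbit would meet its nonvanishing locus.\<close>
  have vanish: "a * I v + b * I' v = 0"
    if "\<And>i. flag_of k (k + r) (v i) \<in> flag_variety k (k + r)" for v
  proof (rule ccontr)
    assume "a * I v + b * I' v \<noteq> 0"
    then have "\<exists>v. (\<forall>i<m. flag_of k (k + r) (v i) \<in> flag_variety k (k + r)) \<and>
        f (flag_minors k (k + r) v) \<noteq> 0"
      unfolding fv using that by (intro exI[of _ v]) simp
    from meets[rule_format, OF f this] 0 show False by blast
  qed
  let ?y = "unit_flags \<iota> (special_index k) :: nat \<Rightarrow> nat \<Rightarrow> 'a^'n"
  \<comment> \<open>Exchanging flags 1 and 2 exchanges \<open>I\<close> and \<open>I'\<close>. As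
    \<open>I' ?y = 0\<close> and \<open>I ?y\<close> is nonzero, \<open>?y\<close> forces
    \<open>a = 0\<close> and \<open>?z\<close> forces \<open>b = 0\<close>.\<close>
  let ?z = "\<lambda>i. ?y (Transposition.transpose 1 2 i)"
  note br = bracket_special[OF k r n_def \<iota>, where 'a = 'a]
  note fl = flag_of_unit_flags[OF k r n_def \<iota>, where 'a = 'a]
  have "a * I ?y + b * I' ?y = 0" "a * I ?z + b * I' ?z = 0"
    by (rule vanish, rule fl)+
  moreover have "?br 0 i j ?z = ?br 0 (Transposition.transpose 1 2 i) (Transposition.transpose 1 2 j) ?y"
    "?br 3 i j ?z = ?br 3 (Transposition.transpose 1 2 i) (Transposition.transpose 1 2 j) ?y" for i j
    by (simp_all add: bracket_def[OF k r n_def \<iota>] transpose_def)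
  ultimately have "a = 0" "b = 0"
    using br by (simp_all add: I_def I'_def transpose_def del: One_nat_def)
  then show False using ab(2) by blast
qed

section \<open>Infinitesimally transitive orbits\<close>

lemma infinite_alg_closed_field: "infinite (UNIV :: 'a::alg_closed_field set)"
proof
  assume fin: "finite (UNIV :: 'a set)"
  \<comment> \<open>If the field were finite, every element would be a root of \<open>p\<close>, and
    \<open>p + 1\<close> would be a nonconstant polynomial without roots.\<close>
  define p where "p = (\<Prod>a\<in>(UNIV :: 'a set). [:- a, 1:])"
  have "degree p = (\<Sum>a\<in>(UNIV :: 'a set). degree [:- a, 1:])"
    unfolding p_def by (rule degree_prod_eq_sum_degree) auto
  also have "\<dots> = card (UNIV :: 'a set)" by simp
  finally have "degree p > 0" using fin by (simp add: card_gt_0_iff)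
  moreover have "degree (p + 1) = degree p"
    using \<open>degree p > 0\<close> by (intro degree_add_eq_left) simp
  ultimately obtain x where "poly (p + 1) x = 0"
    using alg_closed_imp_poly_has_root[of "p + 1"] by auto
  moreover have "poly p x = 0"
    unfolding p_def poly_prod using fin by (intro prod_zero) auto
  ultimately show False by simp
qed

lemma poly_eq_0_if_infinite:
  fixes p :: "'a::idom poly"
  assumes "infinite (UNIV :: 'a set)" "\<And>x. poly p x = 0"
  shows "p = 0"
proof (rule ccontr)
  assume "p \<noteq> 0"
  then have "finite {x. poly p x = 0}" by (rule poly_roots_finite)
  then show False using assms by simp
qed

text \<open>\<open>P\<close> is a polynomial in \<open>t\<close> whose coefficients are polynomials
  in \<open>s\<close>. With \<open>t\<close> as the outer variable, the order of vanishing in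
  \<open>t\<close> can be read from the outer coefficients.\<close>

definition bipoly :: "('a::field \<Rightarrow> 'a \<Rightarrow> 'a) \<Rightarrow> bool" where
  "bipoly g \<longleftrightarrow> (\<exists>P. \<forall>s t. g s t = poly (poly P [:t:]) s)"

lemma bipoly_const: "bipoly (\<lambda>s t. c)"
  unfolding bipoly_def by (rule exI[of _ "[:[:c:]:]"]) simp

lemma bipoly_fst: "bipoly (\<lambda>s t. s)"
  unfolding bipoly_def by (rule exI[of _ "[:[:0, 1:]:]"]) simp

lemma bipoly_snd: "bipoly (\<lambda>s t. t)"
  unfolding bipoly_def by (rule exI[of _ "[:0, 1:]"]) simp

lemma bipoly_add: "bipoly g \<Longrightarrow> bipoly h \<Longrightarrow> bipoly (\<lambda>s t. g s t + h s t)"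
  unfolding bipoly_def by (metis poly_add)

lemma bipoly_mult: "bipoly g \<Longrightarrow> bipoly h \<Longrightarrow> bipoly (\<lambda>s t. g s t * h s t)"
  unfolding bipoly_def by (metis poly_mult)

lemma bipoly_sum: "(\<And>x. x \<in> S \<Longrightarrow> bipoly (g x)) \<Longrightarrow> bipoly (\<lambda>s t. \<Sum>x\<in>S. g x s t)"
  by (induction S rule: infinite_finite_induct) (auto intro: bipoly_const bipoly_add)

lemma bipoly_prod: "(\<And>x. x \<in> S \<Longrightarrow> bipoly (g x)) \<Longrightarrow> bipoly (\<lambda>s t. \<Prod>x\<in>S. g x s t)"
  by (induction S rule: infinite_finite_induct) (auto intro: bipoly_const bipoly_mult)

lemma bipoly_minors:
  assumes "\<And>i x. bipoly (\<lambda>s t. vec_nth (w s t i) x)"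
  shows "bipoly (\<lambda>s t. minors d (w s t) J)"
  unfolding minors_Leibniz by (intro bipoly_sum bipoly_mult bipoly_const bipoly_prod assms)

lemma bipoly_det:
  fixes A :: "'a::field \<Rightarrow> 'a \<Rightarrow> 'a^'n^'n"
  assumes "\<And>i j. bipoly (\<lambda>s t. vec_nth (vec_nth (A s t) i) j)"
  shows "bipoly (\<lambda>s t. Determinants.det (A s t))"
  unfolding Determinants.det_def by (intro bipoly_sum bipoly_mult bipoly_const bipoly_prod assms)

lemma bipoly_multiform:
  assumes "multiform B e f" "\<And>b J. b \<in> B \<Longrightarrow> bipoly (\<lambda>s t. x s t b J)"
  shows "bipoly (\<lambda>s t. f (x s t))"
  using assms(1) by induction (auto intro: bipoly_const bipoly_add bipoly_mult assms(2))

definition eval_fst :: "'a::field \<Rightarrow> 'a poly poly \<Rightarrow> 'a poly" where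
  "eval_fst s P = map_poly (\<lambda>c. poly c s) P"

lemma coeff_eval_fst: "coeff (eval_fst s P) i = poly (coeff P i) s"
  by (simp add: eval_fst_def coeff_map_poly)

lemma poly_eval_fst: "poly (eval_fst s P) t = poly (poly P [:t:]) s"
  by (induction P) (simp_all add: eval_fst_def map_poly_pCons)

text \<open>Evaluating the outer variable at the inner one is the substitution
  \<open>s = t\<close>.\<close>

lemma poly_diagonal:
  fixes P :: "'a::field poly poly"
  shows "poly (poly P [:0, 1:]) t = poly (poly P [:t:]) t"
  by (induction P) simp_all

text \<open>With \<open>d\<close> the least order of vanishing of \<open>F\<close> along the lines through \<open>p\<close>, the order along
  \<open>p + t (y + s z)\<close> is at least \<open>d\<close> for every \<open>s\<close>. Hence \<open>t^d\<close> divides this polynomial in \<open>s\<close> and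
  \<open>t\<close>, and putting \<open>s = t\<close> does not change the coefficient of \<open>t^d\<close>.\<close>

lemma nonzero_along_parabola:
  fixes F :: "('i \<Rightarrow> 'j \<Rightarrow> 'a::field^'n) \<Rightarrow> 'a"
  assumes inf: "infinite (UNIV :: 'a set)"
    and F: "\<And>p y z. bipoly (\<lambda>s t. F (\<lambda>i j. p i j + t *s (y i j + s *s z i j)))"
    and v: "F v \<noteq> 0"
  obtains y where
    "\<And>z. \<exists>Q. Q \<noteq> 0 \<and> (\<forall>t. poly Q t = F (\<lambda>i j. p i j + t *s (y i j + t *s z i j)))"
proof -
  let ?on_line = "\<lambda>y q. \<forall>t. poly q t = F (\<lambda>i j. p i j + t *s y i j)"
  have ex: "\<exists>q. ?on_line y q" for y
  proof -
    obtain P where "\<And>s t. F (\<lambda>i j. p i j + t *s (y i j + s *s 0)) = poly (poly P [:t:]) s"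
      using F[of p y "\<lambda>_ _. 0"] unfolding bipoly_def by blast
    from this[of _ 0] have "?on_line y (eval_fst 0 P)" by (simp add: poly_eval_fst)
    then show ?thesis ..
  qed
  have unique: "q = q'" if "?on_line y q" "?on_line y q'" for y q q'
    using poly_eq_0_if_infinite[OF inf, of "q - q'"] that by simp
  \<comment> \<open>\<open>?ord d\<close> says that \<open>t^d\<close> occurs in the restriction of
    \<open>F\<close> to some line through \<open>p\<close>. The line through \<open>v\<close> shows
    that such a \<open>d\<close> exists, and the least one is taken.\<close>
  let ?ord = "\<lambda>d. \<exists>y q. ?on_line y q \<and> coeff q d \<noteq> 0"
  have "\<exists>d. ?ord d"
  proof -
    obtain q where q: "?on_line (\<lambda>i j. v i j - p i j) q"
      using ex[of "\<lambda>i j. v i j - p i j"] by (rule exE)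
    then have "poly q 1 = F v" by simp
    then have "q \<noteq> 0" using v by auto
    then show ?thesis using q by (meson leading_coeff_neq_0)
  qed
  then obtain d y q where d: "\<forall>i<d. \<not> ?ord i" and y: "?on_line y q" "coeff q d \<noteq> 0"
    unfolding exists_least_iff[of ?ord] by (elim exE conjE) (rule that)
  have "\<exists>Q. Q \<noteq> 0 \<and> (\<forall>t. poly Q t = F (\<lambda>i j. p i j + t *s (y i j + t *s z i j)))" for z
  proof -
    obtain P where P: "\<And>s t. F (\<lambda>i j. p i j + t *s (y i j + s *s z i j)) = poly (poly P [:t:]) s"
      using F[of p y z] unfolding bipoly_def by blast
    have line: "?on_line (\<lambda>i j. y i j + s *s z i j) (eval_fst s P)" for s
      by (simp only: poly_eval_fst P) simp
    have "coeff P i = 0" if "i < d" for i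
    proof (rule poly_eq_0_if_infinite[OF inf])
      fix s
      show "poly (coeff P i) s = 0"
        unfolding coeff_eval_fst[symmetric]
      proof (rule ccontr)
        assume "coeff (eval_fst s P) i \<noteq> 0"
        with line[of s] have "?ord i" by (intro exI conjI)
        then show False using d that by blast
      qed
    qed
    then have "monom 1 d dvd P" by (simp add: monom_1_dvd_iff')
    then obtain P' where P': "P = monom 1 d * P'" by (rule dvdE)
    \<comment> \<open>At \<open>s = 0\<close> the line is the one that attains the minimum, so the
      coefficient of \<open>t^d\<close> is nonzero there. After division by \<open>t^d\<close> and
      the substitution \<open>s = t\<close>, it is the value at \<open>t = 0\<close>.\<close>
    have "eval_fst 0 P = q" using unique[OF _ y(1)] line[of 0] by simp
    then have "poly (coeff P d) 0 \<noteq> 0" using y(2) by (simp flip: coeff_eval_fst)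
    moreover have "coeff P d = coeff P' 0" by (simp add: P' coeff_monom_mult)
    moreover have "poly (poly P' [:0, 1:]) 0 = poly (coeff P' 0) 0"
      unfolding poly_diagonal pCons_0_0 poly_0_coeff_0[of P'] ..
    ultimately have "poly (poly P' [:0, 1:]) 0 \<noteq> 0" by simp
    then have "poly P' [:0, 1:] \<noteq> 0" by auto
    then have "poly P [:0, 1:] \<noteq> 0" by (simp add: P' poly_monom)
    moreover have "poly (poly P [:0, 1:]) t = F (\<lambda>i j. p i j + t *s (y i j + t *s z i j))" for t
      by (simp only: poly_diagonal P)
    ultimately show ?thesis by blast
  qed
  then show ?thesis by (rule that)
qed

text \<open>In contrast to \<open>multiform_scale\<close>, the factors may be 0. This still allows
  passing from \<open>f q\<close> nonzero to \<open>f p\<close> nonzero.\<close>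

lemma multiform_scale_prod:
  assumes "multiform B e f" and "\<And>b. b \<in> B \<Longrightarrow> q b = (\<lambda>J. c b * p b J)"
  shows "f q = (\<Prod>b | e b \<noteq> 0. c b ^ e b) * f p"
proof -
  have "finite {b. e b \<noteq> 0} \<and> f q = (\<Prod>b | e b \<noteq> 0. c b ^ e b) * f p"
    using assms(1)
  proof (induction rule: multiform.induct)
    case (coord b J)
    have "{b'. (if b' = b then 1 else 0 :: nat) \<noteq> 0} = {b}" by auto
    then show ?case using assms(2)[OF coord] by simp
  next
    case (mult e f e' g)
    let ?S = "{b. e b + e' b \<noteq> 0}"
    have fin: "finite ?S"
      by (rule finite_subset[of _ "{b. e b \<noteq> 0} \<union> {b. e' b \<noteq> 0}"]) (use mult in auto)
    have "(\<Prod>b | e b \<noteq> 0. c b ^ e b) = (\<Prod>b\<in>?S. c b ^ e b)"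
      "(\<Prod>b | e' b \<noteq> 0. c b ^ e' b) = (\<Prod>b\<in>?S. c b ^ e' b)"
      by (rule prod.mono_neutral_left; use fin in auto)+
    then show ?case using mult fin by (auto simp: power_add prod.distrib ac_simps)
  qed (auto simp: distrib_left)
  then show ?thesis ..
qed

text \<open>The hypothesis says that the orbit map at the flags spanned by \<open>p\<close> is surjective on tangent
  spaces.\<close>

lemma infinitesimally_transitive_meets:
  fixes p :: "nat \<Rightarrow> nat \<Rightarrow> 'a::field^'n"
  assumes inf: "infinite (UNIV :: 'a set)" and k: "k1 \<le> k2"
    and tangent: "\<And>y. \<exists>X :: 'a^'n^'n. \<forall>i<m. \<forall>j<k2.
      y i j - X *v p i j \<in> vec.span (p i ` {..<if j < k1 then k1 else k2})"
    and f: "multiform ({..<m} \<times> UNIV) e f" and v: "f (flag_minors k1 k2 v) \<noteq> 0"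
  shows "\<exists>A :: 'a^'n^'n. invertible A \<and> f (flag_minors k1 k2 (\<lambda>i j. A *v p i j)) \<noteq> 0"
proof -
  have bip: "bipoly (\<lambda>s t. f (flag_minors k1 k2 (\<lambda>i j. p i j + t *s (y i j + s *s z i j))))"
    for p y z :: "nat \<Rightarrow> nat \<Rightarrow> 'a^'n"
  proof (rule bipoly_multiform[OF f])
    fix b :: "nat \<times> bool" and J :: "nat \<Rightarrow> 'n"
    show "bipoly (\<lambda>s t. flag_minors k1 k2 (\<lambda>i j. p i j + t *s (y i j + s *s z i j)) b J)"
      unfolding flag_minors_def case_prod_beta
      by (intro bipoly_minors)
        (auto intro!: bipoly_add bipoly_mult bipoly_const bipoly_fst bipoly_snd)
  qed
  \<comment> \<open>\<open>y\<close> is obtained before the second-order term \<open>z\<close> is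
    chosen. This order matters, since \<open>z\<close> will be built from a matrix \<open>X\<close>
    that depends on \<open>y\<close>.\<close>
  obtain y where y: "\<And>z. \<exists>Q. Q \<noteq> 0 \<and>
      (\<forall>t. poly Q t = f (flag_minors k1 k2 (\<lambda>i j. p i j + t *s (y i j + t *s z i j))))"
    by (rule nonzero_along_parabola[of "\<lambda>w. f (flag_minors k1 k2 w)" v p, OF inf bip v]) (rule that)
  obtain X :: "'a^'n^'n" where X: "\<And>i j. i < m \<Longrightarrow> j < k2 \<Longrightarrow>
      y i j - X *v p i j \<in> vec.span (p i ` {..<if j < k1 then k1 else k2})"
    using tangent[of y] by (elim exE) (rule that, blast)
  define u where "u i j = y i j - X *v p i j" for i j
  \<comment> \<open>With \<open>z = X u\<close> the parabola factors as
    \<open>p + t (y + t X u) = (1 + t X) (p + t u)\<close>, because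
    \<open>y = X p + u\<close>.\<close>
  obtain Q where Q: "Q \<noteq> 0" and
    Qt: "\<And>t. poly Q t = f (flag_minors k1 k2 (\<lambda>i j. p i j + t *s (y i j + t *s (X *v u i j))))"
    using y[of "\<lambda>i j. X *v u i j"] by (elim exE conjE) (rule that, assumption, erule spec)
  define A where "A t = Finite_Cartesian_Product.mat 1 + (\<chi> i j. t * vec_nth (vec_nth X i) j)" for t
  have AV: "A t *v x = x + t *s (X *v x)" for t x
  proof -
    have "(\<chi> i j. t * vec_nth (vec_nth X i) j) *v x = t *s (X *v x)"
      by (simp add: matrix_vector_mult_def Finite_Cartesian_Product.vec_eq_iff sum_distrib_left mult.assoc)
    then show ?thesis by (simp add: A_def matrix_vector_mult_add_rdistrib)
  qed
  have curve: "p i j + t *s (y i j + t *s (X *v u i j)) = A t *v (p i j + t *s u i j)" for i j t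
  proof -
    have y': "y i j = u i j + X *v p i j" by (simp add: u_def)
    show ?thesis
      by (simp only: AV y' matrix_vector_right_distrib vector_scalar_commute[symmetric]
          vec.scale_right_distrib ac_simps)
  qed
  have "bipoly (\<lambda>s t. Determinants.det (A t))"
    by (intro bipoly_det) (simp add: A_def, intro bipoly_add bipoly_mult bipoly_const bipoly_snd)
  then obtain P where P: "\<And>s t. Determinants.det (A t) = poly (poly P [:t:]) s"
    unfolding bipoly_def by blast
  have "(\<chi> i j. 0 * vec_nth (vec_nth X i) j) = 0"
    by (intro Finite_Cartesian_Product.vec_eq_iff[THEN iffD2] allI) (simp only: vec_lambda_beta mult_zero_left zero_index)
  then have "A 0 = Finite_Cartesian_Product.mat 1" by (simp only: A_def add_0_right)
  then have "poly (eval_fst 0 P) 0 = 1" unfolding poly_eval_fst P[symmetric] by simp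
  then have "eval_fst 0 P \<noteq> 0" by auto
  then have "Q * eval_fst 0 P \<noteq> 0" using Q by simp
  \<comment> \<open>The determinant of \<open>1 + t X\<close> is 1 at \<open>t = 0\<close>, hence
    not the zero polynomial; an infinite field has a \<open>t\<close> avoiding its roots and those
    of \<open>Q\<close>.\<close>
  then obtain t where "poly (Q * eval_fst 0 P) t \<noteq> 0"
    using poly_eq_0_if_infinite[OF inf] by blast
  then have t: "poly Q t \<noteq> 0" "Determinants.det (A t) \<noteq> 0"
    by (simp_all add: poly_eval_fst P[symmetric])
  let ?w = "\<lambda>i j. A t *v p i j" and ?w' = "\<lambda>i j. A t *v (p i j + t *s u i j)"
  \<comment> \<open>The rows \<open>p + t u\<close> lie in the spans of the rows \<open>p\<close>,
    so after applying \<open>A t\<close> their minors are scalar multiples of those of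
    \<open>p\<close>. The scalars need not be known to be nonzero.\<close>
  have inspan: "?w' i j \<in> vec.span (?w i ` {..<d})"
    if i: "i < m" and j: "j < d" and d: "d = k1 \<or> d = k2" for i j d
  proof -
    have "u i j \<in> vec.span (p i ` {..<if j < k1 then k1 else k2})"
      unfolding u_def using X i j d k by (meson less_le_trans)
    moreover have "vec.span (p i ` {..<if j < k1 then k1 else k2}) \<subseteq> vec.span (p i ` {..<d})"
      using j d k by (intro vec.span_mono image_mono) auto
    ultimately have "p i j + t *s u i j \<in> vec.span (p i ` {..<d})"
      using j by (intro vec.span_add vec.span_scale) (auto intro: vec.span_base)
    then have "?w' i j \<in> (*v) (A t) ` vec.span (p i ` {..<d})" by blast
    then show ?thesis
      using vec.linear_span_image[OF matrix_vector_mul_linear_gen, of "A t" "p i ` {..<d}"]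
      by (simp add: image_image)
  qed
  have "\<exists>c. flag_minors k1 k2 ?w' b = (\<lambda>J. c * flag_minors k1 k2 ?w b J)"
    if b: "b \<in> {..<m} \<times> UNIV" for b
  proof -
    obtain i s where bi: "b = (i, s)" "i < m" using b by auto
    have "\<exists>c. \<forall>J. minors (if s then k2 else k1) (?w' i) J = c * minors (if s then k2 else k1) (?w i) J"
      by (rule minors_change) (rule inspan[OF bi(2)], auto)
    then show ?thesis by (auto simp: flag_minors_def bi(1) fun_eq_iff)
  qed
  then have "\<forall>b\<in>{..<m} \<times> UNIV. \<exists>c. flag_minors k1 k2 ?w' b = (\<lambda>J. c * flag_minors k1 k2 ?w b J)" ..
  then obtain c where "\<forall>b\<in>{..<m} \<times> UNIV.
      flag_minors k1 k2 ?w' b = (\<lambda>J. c b * flag_minors k1 k2 ?w b J)"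
    by (rule bchoice[THEN exE])
  then have c: "\<And>b. b \<in> {..<m} \<times> UNIV \<Longrightarrow>
      flag_minors k1 k2 ?w' b = (\<lambda>J. c b * flag_minors k1 k2 ?w b J)" ..
  have "f (flag_minors k1 k2 ?w') \<noteq> 0" using t(1) unfolding Qt curve .
  moreover have "f (flag_minors k1 k2 ?w') = (\<Prod>b | e b \<noteq> 0. c b ^ e b) * f (flag_minors k1 k2 ?w)"
    by (rule multiform_scale_prod[OF f c])
  ultimately have "f (flag_minors k1 k2 ?w) \<noteq> 0"
    by (metis mult_zero_right)
  moreover have "invertible (A t)" using t(2) by (simp add: invertible_det_nz)
  ultimately show ?thesis by blast
qed

section \<open>A dense orbit for three flags\<close>

text \<open>Surjectivity of \<open>(\<beta>, \<alpha>) \<mapsto> \<beta>\<^sub>i \<phi>\<^sub>i - \<phi>\<^sub>i \<alpha>\<close>, where \<open>\<phi> i l q\<close> is the \<open>q\<close>-th coordinate of the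
  image of the \<open>l\<close>-th basis vector under \<open>\<phi>\<^sub>i : K\<^sup>r \<rightarrow> K\<^sup>k\<close>.\<close>

definition ad_surj :: "nat \<Rightarrow> nat \<Rightarrow> (nat \<Rightarrow> nat \<Rightarrow> nat \<Rightarrow> 'a::field) \<Rightarrow> bool" where
  "ad_surj k r \<phi> \<longleftrightarrow> (\<forall>T. \<exists>\<beta> \<alpha>. \<forall>i<3. \<forall>j<r. \<forall>q<k.
     (\<Sum>p<k. \<phi> i j p * \<beta> i p q) - (\<Sum>l<r. \<alpha> j l * \<phi> i l q) = T i j q)"

text \<open>With \<open>K\<^sup>r = X \<oplus> Y \<oplus> Z\<close>, \<open>dim X = dim Y = k\<close>, take \<open>\<phi>\<^sub>0 = x\<close>, \<open>\<phi>\<^sub>1 = y\<close> and \<open>\<phi>\<^sub>2 = x + y + R z\<close> with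
  \<open>R\<close> of full rank.\<close>

lemma ad_surj_large:
  assumes r: "2 * k \<le> r"
  shows "\<exists>\<phi> :: nat \<Rightarrow> nat \<Rightarrow> nat \<Rightarrow> 'a::field. ad_surj k r \<phi>"
proof
  define d :: "nat \<Rightarrow> nat \<Rightarrow> 'a" where "d a b = (if a = b then 1 else 0)" for a b
  let ?\<phi> = "\<lambda>i l q. if i = 0 then d l q else if i = 1 then d l (q + k)
    else d l q + d l (q + k) + d l (q + 2 * k)"
  have dl: "(\<Sum>l<r. v l * d l a) = (if a < r then v a else 0)" for v a
    by (simp add: d_def if_distrib cong: if_cong)
  have dp: "(\<Sum>p<k. d j (p + a) * v p) = (if a \<le> j \<and> j < a + k then v (j - a) else 0)" for v j a
  proof -
    have "(\<Sum>p<k. d j (p + a) * v p) = (\<Sum>p<k. if p = j - a then (if a \<le> j then v p else 0) else 0)"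
      by (intro sum.cong) (auto simp: d_def)
    then show ?thesis by auto
  qed
  have dp0: "(\<Sum>p<k. d j p * v p) = (if j < k then v j else 0)" for v j
    using dp[of j 0 v] by simp
  show "ad_surj k r ?\<phi>"
    unfolding ad_surj_def
  proof
    fix T :: "nat \<Rightarrow> nat \<Rightarrow> nat \<Rightarrow> 'a"
    \<comment> \<open>The first two maps force the entries of \<open>\<alpha>\<close> in the rows
      where they vanish. The third then gives \<open>\<beta>2\<close> from the rows
      \<open>2 * k \<le> j < 3 * k\<close>, with 0 for rows beyond \<open>r\<close>, and afterwards
      the entries of \<open>\<alpha>\<close> still open. Finally \<open>\<beta> 0\<close> and
      \<open>\<beta> 1\<close> absorb the remaining equations.\<close>
    define \<beta>2 where "\<beta>2 p q = (if 2 * k + p < r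
      then T 2 (2 * k + p) q - T 0 (2 * k + p) q - T 1 (2 * k + p) q else 0)" for p q
    define \<alpha> where "\<alpha> j l =
      (if l < k then (if j < k then \<beta>2 j l - T 2 j l + T 1 j l else - T 0 j l)
       else if l < 2 * k then (if k \<le> j \<and> j < 2 * k
         then \<beta>2 (j - k) (l - k) - T 2 j (l - k) + T 0 j (l - k) else - T 1 j (l - k))
       else if 3 * k \<le> j then T 0 j (l - 2 * k) + T 1 j (l - 2 * k) - T 2 j (l - 2 * k) else 0)" for j l
    define \<beta> where "\<beta> i p q = (if i = 0 then T 0 p q + \<alpha> p q
      else if i = 1 then T 1 (k + p) q + \<alpha> (k + p) (q + k) else \<beta>2 p q)" for i p q :: nat
    have "(\<Sum>p<k. ?\<phi> i j p * \<beta> i p q) - (\<Sum>l<r. \<alpha> j l * ?\<phi> i l q) = T i j q"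
      if i: "i < 3" and j: "j < r" and q: "q < k" for i j q
    proof -
      consider "i = 0" | "i = 1" | "i = 2" using i by linarith
      then show ?thesis
      proof cases
        case 1
        then show ?thesis using j q r by (auto simp: dl dp0 \<beta>_def \<alpha>_def)
      next
        case 2
        then show ?thesis using j q r by (auto simp: dl dp \<beta>_def \<alpha>_def)
      next
        case 3
        then have L: "(\<Sum>p<k. ?\<phi> i j p * \<beta> i p q) =
            (if j < k then \<beta>2 j q else 0) + (if k \<le> j \<and> j < k + k then \<beta>2 (j - k) q else 0)
            + (if 2 * k \<le> j \<and> j < 2 * k + k then \<beta>2 (j - 2 * k) q else 0)"
          by (simp add: distrib_right sum.distrib dp dp0 \<beta>_def)
        have R: "(\<Sum>l<r. \<alpha> j l * ?\<phi> i l q) = \<alpha> j q + \<alpha> j (q + k) + (if q + 2 * k < r then \<alpha> j (q + 2 * k) else 0)"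
          using 3 q r by (simp add: distrib_left sum.distrib dl)
        consider "j < k" | "k \<le> j" "j < 2 * k" | "2 * k \<le> j" "j < 3 * k" | "3 * k \<le> j" by linarith
        then show ?thesis
          unfolding L R by cases (use 3 j q r in \<open>simp_all add: \<alpha>_def \<beta>2_def\<close>)
      qed
    qed
    then show "\<exists>\<beta> \<alpha>. \<forall>i<3. \<forall>j<r. \<forall>q<k.
        (\<Sum>p<k. ?\<phi> i j p * \<beta> i p q) - (\<Sum>l<r. \<alpha> j l * ?\<phi> i l q) = T i j q"
      by blast
  qed
qed

text \<open>With \<open>K\<^sup>r = X \<oplus> Y \<oplus> Z\<close>, \<open>dim X = dim Y = c\<close>, \<open>dim Z = e\<close>, the maps \<open>\<phi>\<^sub>0, \<phi>\<^sub>1\<close> are the projections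
  with kernels \<open>X\<close> and \<open>Y\<close>, and \<open>\<phi>\<^sub>2 = (x - y, z - R y)\<close> with \<open>R\<close> of full rank; the matrix \<open>R\<close>
  accounts for the term \<open>d l q\<close> with \<open>c \<le> q\<close>.\<close>

lemma ad_surj_small:
  assumes r: "r = 2 * c + e" and k: "c + e \<le> k" "c = 0 \<or> c + e = k"
  shows "\<exists>\<phi> :: nat \<Rightarrow> nat \<Rightarrow> nat \<Rightarrow> 'a::field. ad_surj k r \<phi>"
proof
  define d :: "nat \<Rightarrow> nat \<Rightarrow> 'a" where "d a b = (if a = b then 1 else 0)" for a b
  define \<phi> where "\<phi> i l q = (if i = 0 then d l (q + c)
    else if i = 1 then (if q < c then d l q else d l (q + c))
    else if q < c then d l q - d l (q + c)
    else if q < 2 * c then d l (q + c) - d l q else d l (q + c))" for i l q :: nat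
  have dl: "(\<Sum>l<r. v l * d l a) = (if a < r then v a else 0)" for v a
    by (simp add: d_def if_distrib cong: if_cong)
  \<comment> \<open>For \<open>q < c + e\<close> this is the \<open>q\<close>-th coordinate of the
    image of \<open>v\<close> under \<open>\<phi> i\<close>. Further coordinates below
    \<open>k\<close>, possible only for \<open>c = 0\<close>, are 0 by \<open>col\<close>.\<close>
  define F where "F i v q = (if i = 0 then v (q + c)
    else if i = 1 then (if q < c then v q else v (q + c))
    else if q < c then v q - v (q + c)
    else if q < 2 * c then v (q + c) - v q else v (q + c))" for i q :: nat and v :: "nat \<Rightarrow> 'a"
  have col: "(\<Sum>l<r. v l * \<phi> i l q) = (if q < c + e then F i v q else 0)" if "q < k" for v i q
  proof -
    have "q + c < r \<longleftrightarrow> q < c + e" "q < c \<Longrightarrow> q < r" "q < 2 * c \<Longrightarrow> q < c + e \<Longrightarrow> q < r"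
      "q < 2 * c \<Longrightarrow> q < c + e" "q < c \<Longrightarrow> q < c + e"
      using that r k by auto
    then show ?thesis
      by (simp add: \<phi>_def F_def dl right_diff_distrib sum_subtractf)
  qed
  have single: "(\<Sum>p<k. \<phi> i j p * v p) = v p" if "p < k" "\<And>p'. p' < k \<Longrightarrow> \<phi> i j p' = d p p'" for i j p v
  proof -
    have "(\<Sum>p<k. \<phi> i j p * v p) = (\<Sum>p'<k. if p' = p then v p' else 0)"
      using that(2) by (intro sum.cong) (auto simp: d_def)
    then show ?thesis using that(1) by simp
  qed
  have row_z: "(\<Sum>p<k. \<phi> i j p * v p) = v (j - c)" if "2 * c \<le> j" "j < r" for i j v
    using that r k by (intro single) (auto simp: \<phi>_def d_def)
  have row_x: "(\<Sum>p<k. \<phi> i j p * v p) = v j" if "j < c" "i \<noteq> 0" for i j v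
    using that r k by (intro single) (auto simp: \<phi>_def d_def)
  have row_x0: "(\<Sum>p<k. \<phi> 0 j p * v p) = 0" if "j < c" for j v
    using that by (intro sum.neutral) (auto simp: \<phi>_def d_def)
  have row_y0: "(\<Sum>p<k. \<phi> 0 j p * v p) = v (j - c)" if "c \<le> j" "j < 2 * c" for j v
    using that r k by (intro single) (auto simp: \<phi>_def d_def)
  have row_y1: "(\<Sum>p<k. \<phi> 1 j p * v p) = 0" if "c \<le> j" "j < 2 * c" for j v
    using that by (intro sum.neutral) (auto simp: \<phi>_def d_def)
  have row_y2: "(\<Sum>p<k. \<phi> 2 j p * v p) = - v (j - c) - (if j < k then v j else 0)"
    if "c \<le> j" "j < 2 * c" for j v
  proof -
    have "(\<Sum>p<k. \<phi> 2 j p * v p) =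
        (\<Sum>p<k. (if p = j - c then - v p else 0) + (if p = j then - v p else 0))"
      using that by (intro sum.cong) (auto simp: \<phi>_def d_def)
    then show ?thesis using that r k by (simp add: sum.distrib)
  qed
  show "ad_surj k r \<phi>"
    unfolding ad_surj_def
  proof
    fix T :: "nat \<Rightarrow> nat \<Rightarrow> nat \<Rightarrow> 'a"
    \<comment> \<open>\<open>x\<close> and \<open>y\<close> hold the entries of
      \<open>\<alpha>\<close> forced by \<open>\<phi> 0\<close> on \<open>X\<close> and by
      \<open>\<phi> 1\<close> on \<open>Y\<close>, where these maps vanish and
      \<open>\<beta>\<close> has no influence. The entries \<open>\<xi>\<close>,
      \<open>\<eta>\<close> and \<open>z\<close> are free.\<close>
    define x where "x j l = (if l < c then 0 else - T 0 j (l - c))" for j l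
    define y where "y j l = (if l < c then - T 1 (c + j) l
      else if l < 2 * c then 0 else - T 1 (c + j) (l - c))" for j l
    \<comment> \<open>\<open>D j\<close> is what the free entries must contribute to the equation of
      \<open>\<phi> 2\<close> at row \<open>c + j\<close>, once \<open>\<beta> 2\<close> is read off
      from the rows of \<open>X\<close> and \<open>Z\<close>. For \<open>j < e\<close> a row of
      \<open>Z\<close> takes all of it; otherwise \<open>e < c\<close>, so only coordinates below
      \<open>2 * c\<close> occur and \<open>\<xi>\<close>, \<open>\<eta>\<close> suffice.\<close>
    define D where "D j q = - T 2 j q - T 2 (c + j) q - (if j < e then T 2 (2 * c + j) q else 0)
      - F 2 (x j) q - F 2 (y j) q" for j q
    define \<eta> where "\<eta> j l = (if j < e then 0 else if l < c + e then - D j l else 0)" for j l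
    define \<xi> where "\<xi> j l = (if j < e then 0 else D j l + \<eta> j (l + c))" for j l
    define z where "z j l = (if c \<le> j then 0 else if l < c then D j l
      else if l < 2 * c then 0 else D j (l - c))" for j l
    define \<alpha> where "\<alpha> j l =
      (if j < c then (if l < c then \<xi> j l else x j l)
       else if j < 2 * c then (if c \<le> l \<and> l < 2 * c then \<eta> (j - c) l else y (j - c) l)
       else z (j - 2 * c) l)" for j l
    \<comment> \<open>For \<open>p < c + e\<close>, \<open>J i p\<close> is the index of a basis
      vector that \<open>\<phi> i\<close> sends to the \<open>p\<close>-th one; its equation defines
      \<open>\<beta> i p\<close>.\<close>
    define J where "J i p = (if i = 0 \<or> c \<le> p then p + c else p)" for i p :: nat
    define \<beta> where "\<beta> i p q = T i (J i p) q + (if q < c + e then F i (\<alpha> (J i p)) q else 0)" for i p q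
    have key: "F 2 (\<alpha> j) q + F 2 (\<alpha> (c + j)) q + (if j < e then F 2 (\<alpha> (2 * c + j)) q else 0)
        = D j q + F 2 (x j) q + F 2 (y j) q" if j: "j < c" and q: "q < c + e" for j q
    proof (cases "j < e")
      case True
      then show ?thesis
        using j q by (auto simp: F_def \<alpha>_def \<xi>_def \<eta>_def z_def x_def y_def)
    next
      case False
      then show ?thesis
        using j q by (auto simp: F_def \<alpha>_def \<xi>_def \<eta>_def x_def y_def)
    qed
    have "(\<Sum>p<k. \<phi> i j p * \<beta> i p q) - (\<Sum>l<r. \<alpha> j l * \<phi> i l q) = T i j q"
      if i: "i < 3" and j: "j < r" and q: "q < k" for i j q
    proof -
      consider "j < c" | "c \<le> j" "j < 2 * c" | "2 * c \<le> j" by linarith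
      then show ?thesis
      proof cases
        case 3
        then have "J i (j - c) = j" by (auto simp: J_def)
        then show ?thesis using 3 j q by (simp add: row_z col \<beta>_def)
      next
        case 1
        show ?thesis
        proof (cases "i = 0")
          case True
          have "c + e = k" using 1 k by auto
          then show ?thesis using 1 True q by (simp add: row_x0 col F_def \<alpha>_def x_def)
        next
          case False
          then have "J i j = j" using 1 by (simp add: J_def)
          then show ?thesis using 1 False q by (simp add: row_x col \<beta>_def)
        qed
      next
        case 2
        then have ke: "c + e = k" using k by auto
        consider "i = 0" | "i = 1" | "i = 2" using i by linarith
        then show ?thesis
        proof cases
          case i: 1
          then have "J 0 (j - c) = j" using 2 by (simp add: J_def)
          then show ?thesis using 2 i q by (simp add: row_y0 col \<beta>_def)
        next
          case i: 2
          show ?thesis using 2 i q ke by (simp only: row_y1 col) (simp add: F_def \<alpha>_def y_def)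
        next
          case i: 3
          define j' where "j' = j - c"
          have j': "j = c + j'" "j' < c" using 2 by (auto simp: j'_def)
          have J: "J 2 j' = j'" "J 2 (c + j') = 2 * c + j'" using j' by (auto simp: J_def)
          have "(c + j' < k) = (j' < e)" using ke by auto
          have regroup: "- t0 - a - u - b = t1" if "a + b + u' = - t0 - t1 - t2" "u = t2 + u'"
            for a b u u' t0 t1 t2 :: 'a
          proof -
            have "- t0 - a - u - b = - t0 - t2 - (a + b + u')" using that(2) by (simp add: algebra_simps)
            then show ?thesis using that(1) by simp
          qed
          have "- T 2 j' q - F 2 (\<alpha> j') q - (if c + j' < k then T 2 (2 * c + j') q + F 2 (\<alpha> (2 * c + j')) q else 0)
              - F 2 (\<alpha> (c + j')) q = T 2 (c + j') q"
          proof (rule regroup)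
            show "F 2 (\<alpha> j') q + F 2 (\<alpha> (c + j')) q + (if j' < e then F 2 (\<alpha> (2 * c + j')) q else 0)
                = - T 2 j' q - T 2 (c + j') q - (if j' < e then T 2 (2 * c + j') q else 0)"
              using key[OF j'(2), of q] q ke unfolding D_def by simp
          qed (use \<open>(c + j' < k) = (j' < e)\<close> in simp)
          then show ?thesis
            using i q j' ke by (simp add: row_y2 col \<beta>_def J cong: if_cong)
        qed
      qed
    qed
    then show "\<exists>\<beta> \<alpha>. \<forall>i<3. \<forall>j<r. \<forall>q<k.
        (\<Sum>p<k. \<phi> i j p * \<beta> i p q) - (\<Sum>l<r. \<alpha> j l * \<phi> i l q) = T i j q"
      by blast
  qed
qed

lemma ad_surj_exists: "\<exists>\<phi> :: nat \<Rightarrow> nat \<Rightarrow> nat \<Rightarrow> 'a::field. ad_surj k r \<phi>"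
proof (cases "2 * k \<le> r")
  case True
  then show ?thesis by (rule ad_surj_large)
next
  case False
  \<comment> \<open>Subtraction is truncated: for \<open>r \<le> k\<close> the parameters are
    \<open>c = 0\<close> and \<open>e = r\<close>, and for \<open>k < r < 2 * k\<close> they satisfy
    \<open>c + e = k\<close>.\<close>
  then show ?thesis
    by (intro ad_surj_small[of r "r - k" "r - 2 * (r - k)"]) auto
qed

section \<open>Three flags in general position and their tangent spaces\<close>

lemma spanning_rows_independent:
  fixes w :: "nat \<Rightarrow> 'a::field^'n"
  assumes "vec.span (w ` {..<CARD('n)}) = UNIV"
  shows "inj_on w {..<CARD('n)}" "vec.independent (w ` {..<CARD('n)})"
proof -
  have dim: "vec.dim (UNIV :: ('a^'n) set) = CARD('n)" by (rule vec_dim_card)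
  have le: "card (w ` {..<CARD('n)}) \<le> CARD('n)"
    using card_image_le[of "{..<CARD('n)}" w] by simp
  show ind: "vec.independent (w ` {..<CARD('n)})"
    by (rule vec.card_le_dim_spanning[of _ UNIV]) (use assms le dim in auto)
  have "card (w ` {..<CARD('n)}) = CARD('n)"
    using vec.dim_eq_card_independent[OF ind] vec.dim_span[of "w ` {..<CARD('n)}"] assms dim by simp
  then show "inj_on w {..<CARD('n)}" by (intro eq_card_imp_inj_on) auto
qed

context
  fixes k r :: nat and A :: "nat \<Rightarrow> nat \<Rightarrow> 'n::finite" and C :: "nat \<Rightarrow> 'n"
  assumes A_eq: "\<And>i p i' p'. i < 3 \<Longrightarrow> p < k \<Longrightarrow> i' < 3 \<Longrightarrow> p' < k \<Longrightarrow> A i p = A i' p' \<longleftrightarrow> i = i' \<and> p = p'"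
    and C_eq: "\<And>j j'. j < r \<Longrightarrow> j' < r \<Longrightarrow> C j = C j' \<longleftrightarrow> j = j'"
    and A_neq_C: "\<And>i p j. i < 3 \<Longrightarrow> p < k \<Longrightarrow> j < r \<Longrightarrow> A i p \<noteq> C j"
    and cover: "\<And>x. (\<exists>i<3. \<exists>p<k. x = A i p) \<or> (\<exists>j<r. x = C j)"
    and card: "CARD('n) = 3 * k + r"
begin

definition vA :: "nat \<Rightarrow> (nat \<Rightarrow> 'a) \<Rightarrow> 'a::field^'n" where
  "vA i w = (\<Sum>p<k. w p *s axis (A i p) 1)"

lemma vA_nth:
  assumes "i < 3"
  shows "i' < 3 \<Longrightarrow> q < k \<Longrightarrow> vec_nth (vA i w) (A i' q) = (if i = i' then w q else 0)"
    and "j < r \<Longrightarrow> vec_nth (vA i w) (C j) = 0"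
proof -
  assume i': "i' < 3" "q < k"
  have "vec_nth (vA i w) (A i' q) = (\<Sum>p<k. if p = q then if i = i' then w q else 0 else 0)"
    unfolding vA_def sum_component
    by (intro sum.cong) (use assms i' A_eq in \<open>auto simp: axis_def\<close>)
  then show "vec_nth (vA i w) (A i' q) = (if i = i' then w q else 0)" using i' by simp
next
  assume "j < r"
  then show "vec_nth (vA i w) (C j) = 0"
    unfolding vA_def sum_component
    by (intro sum.neutral) (use assms A_neq_C in \<open>fastforce simp: axis_def\<close>)
qed

definition nx :: "nat \<Rightarrow> nat" where "nx i = (if i = 2 then 0 else i + 1)"

lemma nx: "i < 3 \<Longrightarrow> nx i < 3" "i < 3 \<Longrightarrow> nx (nx (nx i)) = i"
  "nx i \<noteq> i" "i < 3 \<Longrightarrow> nx (nx i) \<noteq> i" "i < 3 \<Longrightarrow> nx (nx i) \<noteq> nx i"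
  "i < 3 \<Longrightarrow> i' < 3 \<Longrightarrow> i' = i \<or> i' = nx i \<or> i' = nx (nx i)"
  by (auto simp: nx_def split: if_splits)

lemma cover_nx:
  assumes "i < 3"
  shows "(\<exists>q<k. x = A i q) \<or> (\<exists>q<k. x = A (nx i) q) \<or> (\<exists>q<k. x = A (nx (nx i)) q) \<or> (\<exists>j<r. x = C j)"
  using cover[of x] nx(6)[OF assms] by metis

text \<open>\<open>B_i\<close> is \<open>A_i\<close> plus the graph of \<open>\<phi> (nx i)\<close>;
  the maps are indexed by their targets, hence the cyclic shift.\<close>

definition generic_rows :: "(nat \<Rightarrow> nat \<Rightarrow> nat \<Rightarrow> 'a) \<Rightarrow> nat \<Rightarrow> nat \<Rightarrow> 'a::field^'n" where
  "generic_rows \<phi> i j = (if j < k then axis (A i j) 1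
     else axis (C (j - k)) 1 + vA (nx i) (\<phi> (nx i) (j - k)))"

text \<open>The unit vectors of the other two spaces complete the rows to \<open>n\<close> vectors
  that span \<open>V\<close>. These are then independent, and so are the rows among them.\<close>

lemma generic_rows_in_variety:
  fixes \<phi> :: "nat \<Rightarrow> nat \<Rightarrow> nat \<Rightarrow> 'a::field"
  assumes i: "i < 3"
  shows "flag_of k (k + r) (generic_rows \<phi> i) \<in> flag_variety k (k + r)"
proof -
  define w :: "nat \<Rightarrow> 'a^'n" where "w j = (if j < k + r then generic_rows \<phi> i j
    else if j < 2 * k + r then axis (A (nx i) (j - (k + r))) 1
    else axis (A (nx (nx i)) (j - (2 * k + r))) 1)" for j
  let ?S = "vec.span (w ` {..<CARD('n)})"
  have "w j \<in> ?S" if "j < 3 * k + r" for j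
    using that card by (intro vec.span_base) auto
  note S = this
  have 0: "axis (A i q) 1 \<in> ?S" if "q < k" for q
    using S[of q] that by (simp add: w_def generic_rows_def)
  have 1: "axis (A (nx i) q) 1 \<in> ?S" if "q < k" for q
    using S[of "q + (k + r)"] that by (simp add: w_def)
  have 2: "axis (A (nx (nx i)) q) 1 \<in> ?S" if "q < k" for q
    using S[of "q + (2 * k + r)"] that by (simp add: w_def)
  have 3: "axis (C j) 1 \<in> ?S" if "j < r" for j
  proof -
    have "vA (nx i) (\<phi> (nx i) j) \<in> ?S"
      unfolding vA_def by (intro vec.span_sum vec.span_scale 1) simp
    moreover have "axis (C j) 1 + vA (nx i) (\<phi> (nx i) j) \<in> ?S"
      using S[of "k + j"] that by (simp add: w_def generic_rows_def)
    ultimately show ?thesis using vec.span_diff by fastforce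
  qed
  have "axis x 1 \<in> ?S" for x
    using cover_nx[OF i, of x] 0 1 2 3 by blast
  then have "cart_basis \<subseteq> ?S" by (auto simp: cart_basis_def)
  then have "vec.span cart_basis \<subseteq> ?S" by (rule vec.span_minimal) (rule vec.subspace_span)
  then have "?S = UNIV" by (simp add: span_cart_basis top.extremum_unique)
  note ind = spanning_rows_independent[OF this]
  have sub: "{..<k + r} \<subseteq> {..<CARD('n)}" using card by auto
  have eq: "w j = generic_rows \<phi> i j" if "j < k + r" for j using that by (simp add: w_def)
  have "inj_on w {..<k + r}" "vec.independent (w ` {..<k + r})"
    using inj_on_subset[OF ind(1) sub] vec.independent_mono[OF ind(2) image_mono[OF sub]] by blast+
  then have "flag_of k (k + r) w \<in> flag_variety k (k + r)" by (intro flag_of_in_variety) auto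
  moreover have "flag_of k (k + r) w = flag_of k (k + r) (generic_rows \<phi> i)"
    by (simp add: flag_of_def eq cong: image_cong_simp)
  ultimately show ?thesis by simp
qed

text \<open>The hypotheses are the linear equations of \<open>B_i\<close>: the components of
  \<open>v\<close> in \<open>A_i\<close> and \<open>C\<close> serve as coefficients of the
  rows.\<close>

lemma in_span_generic_rows:
  fixes v :: "'a::field^'n"
  assumes i: "i < 3"
    and 1: "\<And>q. q < k \<Longrightarrow> vec_nth v (A (nx i) q) = (\<Sum>l<r. vec_nth v (C l) * \<phi> (nx i) l q)"
    and 2: "\<And>q. q < k \<Longrightarrow> vec_nth v (A (nx (nx i)) q) = 0"
  shows "v \<in> vec.span (generic_rows \<phi> i ` {..<k + r})"
proof -
  let ?s = "vA i (\<lambda>q. vec_nth v (A i q)) + (\<Sum>l<r. vec_nth v (C l) *s generic_rows \<phi> i (k + l))"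
  have g: "generic_rows \<phi> i (k + l) = axis (C l) 1 + vA (nx i) (\<phi> (nx i) l)" for l
    by (simp add: generic_rows_def)
  note nx' = nx(1)[OF i] nx(1)[OF nx(1)[OF i]] nx(3)[of i] nx(4)[OF i] nx(5)[OF i]
  have "vec_nth v x = vec_nth ?s x" for x
    using cover_nx[OF i, of x]
  proof (elim disjE exE conjE)
    fix q assume q: "q < k" "x = A i q"
    then show ?thesis using i nx' A_neq_C by (simp add: g vA_nth axis_def)
  next
    fix q assume q: "q < k" "x = A (nx i) q"
    then show ?thesis using i nx' A_neq_C 1 by (simp add: g vA_nth axis_def)
  next
    fix q assume q: "q < k" "x = A (nx (nx i)) q"
    then show ?thesis using i nx' A_neq_C 2 by (simp add: g vA_nth axis_def)
  next
    fix j assume j: "j < r" "x = C j"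
    have "vec_nth ?s x = (\<Sum>l<r. vec_nth v (C l) * vec_nth (generic_rows \<phi> i (k + l)) (C j))"
      using i j by (simp add: vA_nth)
    also have "\<dots> = (\<Sum>l<r. if l = j then vec_nth v (C j) else 0)"
      using nx' C_eq j by (intro sum.cong) (auto simp: g vA_nth axis_def)
    also have "\<dots> = vec_nth v x" using j by simp
    finally show ?thesis by (rule sym)
  qed
  then have "v = ?s" by (subst Finite_Cartesian_Product.vec_eq_iff) (rule allI)
  moreover have "axis (A i q) 1 \<in> vec.span (generic_rows \<phi> i ` {..<k + r})" if "q < k" for q
    using that by (intro vec.span_base image_eqI[of _ _ q]) (auto simp: generic_rows_def)
  then have "?s \<in> vec.span (generic_rows \<phi> i ` {..<k + r})"
    unfolding vA_def
    by (intro vec.span_add vec.span_sum vec.span_scale vec.span_base[OF imageI]) auto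
  ultimately show ?thesis by simp
qed

lemma matrix_on_axes:
  fixes a :: "nat \<Rightarrow> nat \<Rightarrow> 'a::field^'n" and c :: "nat \<Rightarrow> 'a^'n"
  shows "\<exists>X :: 'a^'n^'n. (\<forall>i<3. \<forall>p<k. X *v axis (A i p) 1 = a i p) \<and> (\<forall>j<r. X *v axis (C j) 1 = c j)"
proof -
  define G where "G x = (if \<exists>j<r. x = C j then c (THE j. j < r \<and> x = C j)
    else (case THE ip. fst ip < 3 \<and> snd ip < k \<and> x = A (fst ip) (snd ip) of (i, p) \<Rightarrow> a i p))" for x
  let ?X = "\<chi> x y. vec_nth (G y) x"
  have X: "?X *v axis y 1 = G y" for y
  proof -
    have "(\<Sum>j\<in>UNIV. vec_nth (G j) x * vec_nth (axis y 1) j)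
        = (\<Sum>j\<in>UNIV. if j = y then vec_nth (G y) x else 0)" for x
      by (intro sum.cong) (auto simp: axis_def)
    then show ?thesis
      by (simp add: matrix_vector_mult_def Finite_Cartesian_Product.vec_eq_iff)
  qed
  have "G (A i p) = a i p" if "i < 3" "p < k" for i p
  proof -
    have "(THE ip. fst ip < 3 \<and> snd ip < k \<and> A i p = A (fst ip) (snd ip)) = (i, p)"
      using that A_eq by (intro the_equality) auto
    then show ?thesis using that A_neq_C by (auto simp: G_def)
  qed
  moreover have "G (C j) = c j" if "j < r" for j
  proof -
    have "(THE j'. j' < r \<and> C j = C j') = j"
      using that C_eq by (intro the_equality) auto
    then show ?thesis using that by (auto simp: G_def)
  qed
  ultimately show ?thesis using X by (intro exI[of _ ?X]) simp
qed

text \<open>On \<open>A_i\<close>, \<open>X\<close> is \<open>y\<close> up to a correction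
  \<open>\<beta>\<close> inside \<open>A_i\<close>; on \<open>C\<close> it is \<open>\<xi>\<close>.
  Membership in \<open>B_i\<close> constrains the components in the two other spaces: the one in
  \<open>A_{i+2}\<close> fixes the \<open>A\<close>-part of \<open>\<xi>\<close>, the one in
  \<open>A_{i+1}\<close> becomes \<open>ad_surj\<close> with \<open>\<alpha>\<close> as the
  \<open>C\<close>-part of \<open>\<xi>\<close>.\<close>

lemma generic_rows_tangent:
  fixes \<phi> :: "nat \<Rightarrow> nat \<Rightarrow> nat \<Rightarrow> 'a::field" and y :: "nat \<Rightarrow> nat \<Rightarrow> 'a^'n"
  assumes \<phi>: "ad_surj k r \<phi>"
  shows "\<exists>X :: 'a^'n^'n. \<forall>i<3. \<forall>j<k + r. y i j - X *v generic_rows \<phi> i j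
    \<in> vec.span (generic_rows \<phi> i ` {..<if j < k then k else k + r})"
proof -
  \<comment> \<open>What remains of \<open>y\<close> in row \<open>k + j\<close> after subtracting
    the part of \<open>X\<close> that \<open>y\<close> prescribes on \<open>A_{i+1}\<close>.\<close>
  define \<eta> where "\<eta> i j = y i (k + j) - (\<Sum>p<k. \<phi> (nx i) j p *s y (nx i) p)" for i j
  \<comment> \<open>Here \<open>i\<close> is the target of the map, so the flag concerned is
    \<open>nx (nx i)\<close>. The second term is the \<open>A_i\<close>-component of
    \<open>\<xi> j\<close>.\<close>
  define T where "T i j q = vec_nth (\<eta> (nx (nx i)) j) (A i q) - vec_nth (\<eta> (nx i) j) (A i q)
    - (\<Sum>l<r. vec_nth (\<eta> (nx (nx i)) j) (C l) * \<phi> i l q)" for i j q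
  obtain \<beta> \<alpha> where "\<forall>i<3. \<forall>j<r. \<forall>q<k.
     (\<Sum>p<k. \<phi> i j p * \<beta> i p q) - (\<Sum>l<r. \<alpha> j l * \<phi> i l q) = T i j q"
    using \<phi>[unfolded ad_surj_def, THEN spec, of T] by (elim exE) (rule that)
  then have sol: "(\<Sum>p<k. \<phi> i j p * \<beta> i p q) - (\<Sum>l<r. \<alpha> j l * \<phi> i l q) = T i j q"
    if "i < 3" "j < r" "q < k" for i j q
    using that by blast
  define \<xi> where "\<xi> j = (\<Sum>i<3. vA i (\<lambda>q. vec_nth (\<eta> (nx i) j) (A i q)))
    + (\<Sum>l<r. \<alpha> j l *s axis (C l) 1)" for j
  have \<xi>A: "vec_nth (\<xi> j) (A i q) = vec_nth (\<eta> (nx i) j) (A i q)" if "i < 3" "q < k" for i j q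
  proof -
    have "vec_nth (\<Sum>i'<3. vA i' (\<lambda>q. vec_nth (\<eta> (nx i') j) (A i' q))) (A i q)
        = (\<Sum>i'<3. if i' = i then vec_nth (\<eta> (nx i) j) (A i q) else 0)"
      unfolding sum_component by (intro sum.cong) (use that in \<open>auto simp: vA_nth\<close>)
    moreover have "vec_nth (\<Sum>l<r. \<alpha> j l *s axis (C l) 1) (A i q) = 0"
      unfolding sum_component by (intro sum.neutral) (use that A_neq_C in \<open>auto simp: axis_def\<close>)
    ultimately show ?thesis using that by (simp add: \<xi>_def)
  qed
  have \<xi>C: "vec_nth (\<xi> j) (C l) = \<alpha> j l" if "l < r" for j l
  proof -
    have "vec_nth (\<Sum>i'<3. vA i' (\<lambda>q. vec_nth (\<eta> (nx i') j) (A i' q))) (C l) = 0"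
      unfolding sum_component by (intro sum.neutral) (use that in \<open>auto simp: vA_nth\<close>)
    moreover have "vec_nth (\<Sum>l<r. \<alpha> j l *s axis (C l) 1) (C l) = (\<Sum>l'<r. if l' = l then \<alpha> j l else 0)"
      unfolding sum_component by (intro sum.cong) (use that C_eq in \<open>auto simp: axis_def\<close>)
    ultimately show ?thesis using that by (simp add: \<xi>_def)
  qed
  obtain X :: "'a^'n^'n" where XA: "\<And>i p. i < 3 \<Longrightarrow> p < k \<Longrightarrow> X *v axis (A i p) 1 = y i p + vA i (\<beta> i p)"
    and XC: "\<And>j. j < r \<Longrightarrow> X *v axis (C j) 1 = \<xi> j"
    using matrix_on_axes[of "\<lambda>i p. y i p + vA i (\<beta> i p)" \<xi>] by blast
  have small: "y i j - X *v generic_rows \<phi> i j \<in> vec.span (generic_rows \<phi> i ` {..<k})"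
    if "i < 3" "j < k" for i j
  proof -
    have "axis (A i q) 1 \<in> vec.span (generic_rows \<phi> i ` {..<k})" if "q < k" for q
      using that by (intro vec.span_base image_eqI[of _ _ q]) (auto simp: generic_rows_def)
    then have "vA i (\<beta> i j) \<in> vec.span (generic_rows \<phi> i ` {..<k})"
      unfolding vA_def by (intro vec.span_sum vec.span_scale) auto
    moreover have "y i j - X *v generic_rows \<phi> i j = - vA i (\<beta> i j)"
      using that by (simp add: generic_rows_def XA)
    ultimately show ?thesis using vec.span_neg by metis
  qed
  have large: "y i (k + j) - X *v generic_rows \<phi> i (k + j) \<in> vec.span (generic_rows \<phi> i ` {..<k + r})"
    if i: "i < 3" and j: "j < r" for i j
  proof -
    define i' where "i' = nx i"
    have i': "i' < 3" "nx i' < 3" "nx (nx i') = i" "i' \<noteq> nx i'"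
      using nx(1)[OF i] nx(1)[OF nx(1)[OF i]] nx(2)[OF i] nx(5)[OF i] by (auto simp: i'_def)
    have lin: "Vector_Spaces.linear (*s) (*s) ((*v) X)" by (rule matrix_vector_mul_linear_gen)
    have "X *v vA i' w = (\<Sum>p<k. w p *s (y i' p + vA i' (\<beta> i' p)))" for w
      unfolding vA_def[of i' w] vec.linear_sum[OF lin] using i' XA
      by (intro sum.cong) (auto simp: vec.linear_scale[OF lin])
    then have X: "X *v generic_rows \<phi> i (k + j)
        = \<xi> j + (\<Sum>p<k. \<phi> i' j p *s (y i' p + vA i' (\<beta> i' p)))"
      using XC[OF j] by (simp add: generic_rows_def matrix_vector_right_distrib i'_def)
    define v where "v = y i (k + j) - X *v generic_rows \<phi> i (k + j)"
    have v: "v = \<eta> i j - \<xi> j - (\<Sum>p<k. \<phi> i' j p *s vA i' (\<beta> i' p))"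
      unfolding v_def X \<eta>_def i'_def[symmetric]
      by (simp add: vec.scale_right_distrib sum.distrib)
    have vC: "vec_nth v (C l) = vec_nth (\<eta> i j) (C l) - \<alpha> j l" if "l < r" for l
      using that i' by (simp add: v \<xi>C vA_nth)
    have "v \<in> vec.span (generic_rows \<phi> i ` {..<k + r})"
    proof (rule in_span_generic_rows[OF i])
      fix q assume q: "q < k"
      have "vec_nth v (A i' q) = vec_nth (\<eta> i j) (A i' q) - vec_nth (\<eta> (nx i') j) (A i' q)
          - (\<Sum>p<k. \<phi> i' j p * \<beta> i' p q)"
        using q i' by (simp add: v \<xi>A vA_nth)
      also have "\<dots> = (\<Sum>l<r. vec_nth (\<eta> i j) (C l) * \<phi> i' l q) - (\<Sum>l<r. \<alpha> j l * \<phi> i' l q)"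
        using sol[OF i'(1) j q] by (simp add: T_def i' algebra_simps)
      also have "\<dots> = (\<Sum>l<r. vec_nth v (C l) * \<phi> i' l q)"
        by (simp add: vC left_diff_distrib sum_subtractf)
      finally show "vec_nth v (A (nx i) q) = (\<Sum>l<r. vec_nth v (C l) * \<phi> (nx i) l q)"
        unfolding i'_def .
      show "vec_nth v (A (nx (nx i)) q) = 0"
        using q i' unfolding i'_def[symmetric] by (simp add: v \<xi>A vA_nth)
    qed
    then show ?thesis unfolding v_def .
  qed
  show ?thesis
  proof (intro exI allI impI)
    fix i j :: nat assume i: "i < 3" "j < k + r"
    show "y i j - X *v generic_rows \<phi> i j
        \<in> vec.span (generic_rows \<phi> i ` {..<if j < k then k else k + r})"
      using small[OF i(1), of j] large[OF i(1), of "j - k"] i(2) by (cases "j < k") auto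
  qed
qed

end

section \<open>Density for at most three flags, and the equivalence\<close>

lemma diag_act_dense:
  assumes card: "CARD('n::finite) = 3 * k + r" and m: "m \<le> 3" and inf: "infinite (UNIV :: 'a::field set)"
  shows "dense_action (PGL :: ('a^'n^'n) set monoid) (diag_act m) (flag_zariski k (k + r) m)"
proof -
  obtain \<iota> :: "nat \<Rightarrow> 'n" where \<iota>: "bij_betw \<iota> {..<3 * k + r} UNIV"
    using ex_bij_betw_nat_finite[of "UNIV :: 'n set"] card by (auto simp: atLeast0LessThan)
  \<comment> \<open>The coordinates are cut into three blocks of length \<open>k\<close> for the
    \<open>A_i\<close> and one of length \<open>r\<close> for \<open>C\<close>.\<close>
  define A where "A i p = \<iota> (k * i + p)" for i p
  define C where "C j = \<iota> (3 * k + j)" for j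
  have \<iota>_eq: "\<iota> a = \<iota> b \<longleftrightarrow> a = b" if "a < 3 * k + r" "b < 3 * k + r" for a b
    using \<iota> that by (auto simp: bij_betw_def inj_on_def)
  have bound: "k * i + p < 3 * k" if "i < 3" "p < k" for i p
  proof -
    have "k * i \<le> k * 2" using that by (intro mult_le_mono2) simp
    then show ?thesis using that(2) by linarith
  qed
  have A_eq: "A i p = A i' p' \<longleftrightarrow> i = i' \<and> p = p'"
    if "i < 3" "p < k" "i' < 3" "p' < k" for i p i' p'
  proof -
    have "k * i + p = k * i' + p' \<longleftrightarrow> i = i' \<and> p = p'"
    proof
      assume eq: "k * i + p = k * i' + p'"
      have "i = (k * i + p) div k" "i' = (k * i' + p') div k" using that by simp_all
      then have "i = i'" using eq by simp
      then show "i = i' \<and> p = p'" using eq by simp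
    qed simp
    then show ?thesis
      using bound[OF that(1,2)] bound[OF that(3,4)] by (simp add: A_def \<iota>_eq)
  qed
  have C_eq: "C j = C j' \<longleftrightarrow> j = j'" if "j < r" "j' < r" for j j'
    using that by (simp add: C_def \<iota>_eq)
  have A_neq_C: "A i p \<noteq> C j" if "i < 3" "p < k" "j < r" for i p j
    using bound[OF that(1,2)] that by (simp add: A_def C_def \<iota>_eq)
  have cover: "(\<exists>i<3. \<exists>p<k. x = A i p) \<or> (\<exists>j<r. x = C j)" for x
  proof -
    obtain a where a: "x = \<iota> a" "a < 3 * k + r" using \<iota> by (auto simp: bij_betw_def)
    show ?thesis
    proof (cases "a < 3 * k")
      case True
      then have "0 < k" by (cases k) auto
      then have "a div k < 3" "a mod k < k" "x = A (a div k) (a mod k)"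
        using True by (auto simp: A_def a less_mult_imp_div_less)
      then show ?thesis by blast
    next
      case False
      then have "a - 3 * k < r" "x = C (a - 3 * k)" using a by (auto simp: C_def)
      then show ?thesis by blast
    qed
  qed
  note rows = A_eq C_eq A_neq_C cover
  obtain \<phi> :: "nat \<Rightarrow> nat \<Rightarrow> nat \<Rightarrow> 'a" where \<phi>: "ad_surj k r \<phi>" using ad_surj_exists by blast
  let ?p = "generic_rows k A C \<phi> :: nat \<Rightarrow> nat \<Rightarrow> 'a^'n"
  show ?thesis
    unfolding dense_action_iff
  proof (intro exI[of _ ?p] conjI allI impI)
    fix i assume "i < m"
    then show "flag_of k (k + r) (?p i) \<in> flag_variety k (k + r)"
      using m by (intro generic_rows_in_variety[OF rows card]) auto
  next
    fix e and f :: "(nat \<times> bool \<Rightarrow> (nat \<Rightarrow> 'n) \<Rightarrow> 'a) \<Rightarrow> 'a"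
    assume f: "multiform ({..<m} \<times> UNIV) e f"
      and "\<exists>v. (\<forall>i<m. flag_of k (k + r) (v i) \<in> flag_variety k (k + r)) \<and> f (flag_minors k (k + r) v) \<noteq> 0"
    then obtain v where v: "f (flag_minors k (k + r) v) \<noteq> 0" by blast
    show "\<exists>A :: 'a^'n^'n. invertible A \<and> f (flag_minors k (k + r) (\<lambda>i j. A *v ?p i j)) \<noteq> 0"
    proof (rule infinitesimally_transitive_meets[OF inf _ _ f v])
      fix y :: "nat \<Rightarrow> nat \<Rightarrow> 'a^'n"
      \<comment> \<open>A solution for all three flags also serves the first \<open>m\<close> of
        them.\<close>
      obtain X :: "'a^'n^'n" where "\<And>i j. i < 3 \<Longrightarrow> j < k + r \<Longrightarrow>
          y i j - X *v ?p i j \<in> vec.span (?p i ` {..<if j < k then k else k + r})"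
        using generic_rows_tangent[OF rows card \<phi>, of y] by blast
      then show "\<exists>X :: 'a^'n^'n. \<forall>i<m. \<forall>j<k + r.
          y i j - X *v ?p i j \<in> vec.span (?p i ` {..<if j < k then k else k + r})"
        using m by (intro exI[of _ X]) auto
    qed simp
  qed
qed

theorem corollary4p2:
  fixes k n m :: nat
  assumes "0 < k" and "0 < n" and "0 < m"
    and "CARD('n::finite) = n"
    and "int k < int n - 2 * int k"
  shows "dense_action (PGL :: ('a::alg_closed_field^'n^'n) set monoid) (diag_act m)
           (flag_zariski k (n - 2 * k) m) \<longleftrightarrow> m \<le> 3"
proof -
  define r where "r = n - 3 * k"
  have r: "n = 3 * k + r" "0 < r" using assms(5) by (auto simp: r_def)
  have k2: "n - 2 * k = k + r" using r(1) by simp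
  have card: "CARD('n) = 3 * k + r" using assms(4) r(1) by simp
  let ?dense = "dense_action (PGL :: ('a^'n^'n) set monoid) (diag_act m) (flag_zariski k (k + r) m)"
  have "\<not> ?dense" if "4 \<le> m" by (rule diag_act_not_dense[OF assms(1) r(2) card that])
  moreover have "?dense" if "m \<le> 3" by (rule diag_act_dense[OF card that infinite_alg_closed_field])
  ultimately show ?thesis unfolding k2 by linarith
qed

end
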